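(* Among all the nonbipartite graphs with both order $n$ and domination number $\gamma$, we have: (i) if $n=3\gamma-1,\ 3\gamma,\ 3\gamma+1$, then the minimal least $Q$-eigenvalue is attained uniquely at $C_{3,\,n-4}^{*}$; (ii) if $n\geq 3\gamma+2$, then the minimal least $Q$-eigenvalue is attained uniquely at $C_{3,\,3\gamma-3}^{*}$.
   Context: All graphs are connected, undirected and simple (no loops or multiple edges). The order of a graph is its number of vertices. A dominating set of a graph $G$ is a set $D\subseteq V(G)$ such that every vertex of $V(G)\setminus D$ is adjacent to at least one vertex of $D$; the domination number $\gamma=\gamma(G)$ is the minimum cardinality of all dominating sets of $G$. The signless Laplacian matrix of $G$ is $Q(G)=D(G)+A(G)$, where $D(G)$ is the diagonal matrix of vertex degrees and $A(G)$ is the adjacency matrix; the least $Q$-eigenvalue of $G$ is the least eigenvalue of $Q(G)$. For an odd number $s\ge 3$, $C_{s,\,l}^{*}$ is the graph of order $n$ obtained by attaching a cycle $C_s$ of length $s$ to an end vertex of a path $P_{l+1}$ on $l+1$ vertices (a vertex of $C_s$ is identified with that end vertex) and attaching $n-s-l$ pendant edges to the other end vertex of $P_{l+1}$; in particular, $l=0$ means attaching $n-s$ pendant edges to a vertex of $C_s$. *)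

theory Defs
  imports
    Graph_Theory.Graph_Theory
    Jordan_Normal_Form.Spectral_Radius
begin

(* A finite simple undirected graph is a pair_graph: an undirected edge {u, v} is represented by
   the two arcs (u, v) and (v, u). *)

definition bipartite :: "'a pair_pre_digraph \<Rightarrow> bool" where
  "bipartite G \<longleftrightarrow> (\<exists>X Y. X \<union> Y = pverts G \<and> X \<inter> Y = {} \<and>
     (\<forall>(u, v) \<in> parcs G. (u \<in> X \<and> v \<in> Y) \<or> (u \<in> Y \<and> v \<in> X)))"

definition dominating_set :: "'a pair_pre_digraph \<Rightarrow> 'a set \<Rightarrow> bool" where
  "dominating_set G D \<longleftrightarrow> D \<subseteq> pverts G \<and> (\<forall>v \<in> pverts G - D. \<exists>u \<in> D. (v, u) \<in> parcs G)"

definition domination_number :: "'a pair_pre_digraph \<Rightarrow> nat" where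
  "domination_number G = Min (card ` {D. dominating_set G D})"

(* Matrices are indexed by 0, ..., n - 1, so the vertices are listed in some order; the spectrum
   of the signless Laplacian does not depend on the order chosen. *)

definition vertex_list :: "'a pair_pre_digraph \<Rightarrow> 'a list" where
  "vertex_list G = (SOME vs. distinct vs \<and> set vs = pverts G)"

definition adjacency_matrix :: "'a pair_pre_digraph \<Rightarrow> real mat" where
  "adjacency_matrix G = (let vs = vertex_list G; n = card (pverts G) in
     mat n n (\<lambda>(i, j). if (vs ! i, vs ! j) \<in> parcs G then 1 else 0))"

(* In a symmetric digraph the out-degree of a vertex is its degree as a vertex of the
   undirected graph. *)

definition degree_matrix :: "'a pair_pre_digraph \<Rightarrow> real mat" where
  "degree_matrix G = (let vs = vertex_list G; n = card (pverts G) in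
     mat n n (\<lambda>(i, j). if i = j then real (out_degree (with_proj G) (vs ! i)) else 0))"

definition signless_laplacian :: "'a pair_pre_digraph \<Rightarrow> real mat" where
  "signless_laplacian G = degree_matrix G + adjacency_matrix G"

(* The matrix is real symmetric, so all its eigenvalues are real. *)

definition least_Q_eigenvalue :: "'a pair_pre_digraph \<Rightarrow> real" where
  "least_Q_eigenvalue G = Min (spectrum (signless_laplacian G))"

definition nonbipartite_graphs :: "nat \<Rightarrow> nat \<Rightarrow> 'a pair_pre_digraph set" where
  "nonbipartite_graphs n \<gamma> = {G. pair_graph G \<and> Digraph_Component.connected (with_proj G) \<and>
     \<not> bipartite G \<and> card (pverts G) = n \<and> domination_number G = \<gamma>}"

(* The graph C*_(s,l) of order n, for s + l <= n, on the vertices 0, ..., n - 1: the cycle runs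
   through 0, ..., s - 1, the path P_(l+1) through s - 1, ..., s + l - 1, and the pendant vertices
   s + l, ..., n - 1 are attached to s + l - 1. *)

definition Cstar_edges :: "nat \<Rightarrow> nat \<Rightarrow> nat \<Rightarrow> nat rel" where
  "Cstar_edges n s l =
     {(i, Suc i mod s) | i. i < s} \<union>
     {(i, Suc i) | i. s - 1 \<le> i \<and> i < s + l - 1} \<union>
     {(s + l - 1, j) | j. s + l \<le> j \<and> j < n}"

definition Cstar :: "nat \<Rightarrow> nat \<Rightarrow> nat \<Rightarrow> nat pair_pre_digraph" where
  "Cstar n s l = \<lparr>pverts = {..<n}, parcs = Cstar_edges n s l \<union> (Cstar_edges n s l)\<inverse>\<rparr>"

end

theory Submission
  imports Defs "HOL-Analysis.Function_Topology"
begin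

text \<open>
  The least \<open>Q\<close>-eigenvalue is the minimum of the quotient of \<open>\<Sum> (x u + x v)\<^sup>2\<close>, over the edges
  \<open>uv\<close>, by \<open>\<Sum> (x v)\<^sup>2\<close>, over the vertices (\<open>least_Q_eigenvalue_rayleigh\<close>). With \<open>y = \<bar>x\<bar>\<close>,
  an edge whose ends have opposite signs contributes \<open>(y u - y v)\<^sup>2\<close>, and an edge whose ends have
  equal signs contributes \<open>4 * y u * y v\<close> more. A nonbipartite graph has at least one edge of the second
  kind. In \<open>Cstar\<close>, seen as a triangle \<open>0, 1, 2\<close>, a path \<open>2, \<dots>, m - 1\<close> and pendant vertices
  \<open>m, \<dots>, n - 1\<close> at \<open>m - 1\<close>, the signs can be chosen such that \<open>01\<close> is the only one; this gives
  \<open>kite_form\<close>.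

  The comparison of any graph with \<open>Cstar\<close> (\<open>least_Q_eigenvalue_ge_Cstar\<close>) starts from a connected
  nonbipartite set \<open>S\<close> of \<open>m\<close> vertices to which every other vertex is adjacent, and from an
  eigenvector \<open>x\<close> for the least eigenvalue. A minimal nonbipartite subset of \<open>S\<close> induces a graph of
  minimum degree at least two. Let \<open>ab\<close>, with \<open>y a \<le> y b\<close>, be an edge of this induced graph for which
  \<open>y a * y b\<close> is least, and let \<open>ap\<close> and \<open>bq\<close> be further edges of it at \<open>a\<close> and at \<open>b\<close>.
  List \<open>S\<close> as \<open>a\<close>, \<open>b\<close>, followed by the other vertices in the order of the values \<open>max (y v) (y b)\<close>.
  As \<open>S\<close> is connected, each gap between consecutive values after the first two is bridged by an edge,
  and an edge contributes at least the sum of the squares of all gaps that it bridges. The edges \<open>ap\<close> and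
  \<open>bq\<close> contribute in addition what the edges \<open>02\<close> and \<open>12\<close> contribute in \<open>Cstar\<close>, and an edge with ends
  of equal signs contributes at least \<open>4 * y a * y b\<close> more than its share. A vertex outside \<open>S\<close> does
  best if it is joined to a vertex with the largest value. So the value of the form at \<open>x\<close> is at least
  the one that \<open>Cstar\<close> has at the sorted values.

  If the eigenvalues agree, then the sorted values minimise the quotient for \<open>kite_form\<close>. The
  stationarity equations show that they increase strictly after two equal initial entries. Then every edge
  must contribute exactly its share, and this leaves only the edges of \<open>Cstar\<close> (\<open>edges_eq\<close>).

  It remains to choose \<open>S\<close>. For \<open>n \<le> 3 * \<gamma> + 1\<close> it consists of all vertices. Otherwise let \<open>D\<close> be a
  minimum dominating set. Two parts of \<open>D\<close> can always be joined through at most two further vertices, so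
  that \<open>D\<close> lies in a connected set of at most \<open>3 * \<gamma> - 2\<close> vertices. Two more vertices suffice to make it
  nonbipartite, and any further vertices keep it connected (\<open>dominated_core_exists\<close>), so that
  \<open>m = 3 * \<gamma>\<close> can be reached.
\<close>

section \<open>The quadratic form of the extremal graph\<close>

text \<open>The edges \<open>ij\<close> with \<open>i < j\<close> of \<open>Cstar n 3 (m - 3)\<close> (see \<open>Cstar_arcs\<close>).\<close>

definition kite_edges :: "nat \<Rightarrow> nat \<Rightarrow> nat rel" where
  "kite_edges n m = {(0, 1), (0, 2), (1, 2)} \<union> {(i, Suc i) | i. 2 \<le> i \<and> Suc i < m} \<union>
     {(m - 1, j) | j. m \<le> j \<and> j < n}"

text \<open>The form of \<open>Cstar n 3 (m - 3)\<close> after a change of signs that gives the ends of every edge except \<open>01\<close>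
  opposite signs.\<close>

definition kite_form :: "nat \<Rightarrow> nat \<Rightarrow> (nat \<Rightarrow> real) \<Rightarrow> real" where
  "kite_form n m w = (w 0 + w 1)\<^sup>2 + (w 2 - w 0)\<^sup>2 + (w 2 - w 1)\<^sup>2 +
     (\<Sum>i = 2..<m - 1. (w (Suc i) - w i)\<^sup>2) + (\<Sum>j = m..<n. (w j - w (m - 1))\<^sup>2)"

text \<open>Over a set of edges with one orientation each this is the signless Laplacian form; over the arcs of
  a symmetric digraph it is twice that form.\<close>

definition energy :: "('a \<times> 'a) set \<Rightarrow> ('a \<Rightarrow> real) \<Rightarrow> real" where
  "energy E x = (\<Sum>(u, v)\<in>E. (x u + x v)\<^sup>2)"

text \<open>An edge that bridges several gaps of an increasing sequence contributes at least the squares of all of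
  them, because the mixed products are nonnegative.\<close>

lemma sum_gaps_le:
  fixes z :: "nat \<Rightarrow> real"
  assumes "a \<le> b" "\<And>i. a \<le> i \<Longrightarrow> i < b \<Longrightarrow> z i \<le> z (Suc i)"
  shows "z a \<le> z b \<and> (\<Sum>i = a..<b. (z (Suc i) - z i)\<^sup>2) \<le> (z b - z a)\<^sup>2"
  using assms
proof (induction b rule: nat_induct_at_least)
  case (Suc b)
  then have IH: "z a \<le> z b" "(\<Sum>i = a..<b. (z (Suc i) - z i)\<^sup>2) \<le> (z b - z a)\<^sup>2"
    and le: "z b \<le> z (Suc b)" by auto
  have "(z (Suc b) - z a)\<^sup>2 = (z (Suc b) - z b)\<^sup>2 + (z b - z a)\<^sup>2 + 2 * ((z (Suc b) - z b) * (z b - z a))"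
    by (simp add: power2_eq_square algebra_simps)
  moreover have "0 \<le> (z (Suc b) - z b) * (z b - z a)" using IH le by simp
  moreover have "(\<Sum>i = a..<Suc b. (z (Suc i) - z i)\<^sup>2) = (\<Sum>i = a..<b. (z (Suc i) - z i)\<^sup>2) + (z (Suc b) - z b)\<^sup>2"
    using Suc.hyps by simp
  ultimately show ?case using IH le by linarith
qed simp

lemma sum_gaps_less:
  fixes z :: "nat \<Rightarrow> real"
  assumes "Suc a < b" "\<And>i. a \<le> i \<Longrightarrow> i < b \<Longrightarrow> z i < z (Suc i)"
  shows "(\<Sum>i = a..<b. (z (Suc i) - z i)\<^sup>2) < (z b - z a)\<^sup>2"
proof -
  obtain c where c: "b = Suc c" "a < c" using assms(1) by (cases b) auto
  have l: "z a < z (Suc a)" "z c < z (Suc c)" using assms c by auto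
  have "z (Suc a) \<le> z c \<and> (\<Sum>i = Suc a..<c. (z (Suc i) - z i)\<^sup>2) \<le> (z c - z (Suc a))\<^sup>2"
    using c assms(2) by (intro sum_gaps_le) (auto intro: less_imp_le)
  moreover have "z a \<le> z c \<and> (\<Sum>i = a..<c. (z (Suc i) - z i)\<^sup>2) \<le> (z c - z a)\<^sup>2"
    using c assms(2) by (intro sum_gaps_le) (auto intro: less_imp_le)
  moreover have "0 < (z (Suc c) - z c) * (z c - z a)" using calculation l by auto
  moreover have "(z (Suc c) - z a)\<^sup>2 = (z (Suc c) - z c)\<^sup>2 + (z c - z a)\<^sup>2 + 2 * ((z (Suc c) - z c) * (z c - z a))"
    by (simp add: power2_eq_square algebra_simps)
  moreover have "(\<Sum>i = a..<b. (z (Suc i) - z i)\<^sup>2) = (\<Sum>i = a..<c. (z (Suc i) - z i)\<^sup>2) + (z (Suc c) - z c)\<^sup>2"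
    using c by simp
  ultimately show ?thesis unfolding c by linarith
qed

lemma square_split_le:
  fixes a b c :: real
  assumes "a \<le> b" "b \<le> c"
  shows "(b - a)\<^sup>2 + (c - b)\<^sup>2 \<le> (c - a)\<^sup>2"
proof -
  have "(c - a)\<^sup>2 = (b - a)\<^sup>2 + (c - b)\<^sup>2 + 2 * ((b - a) * (c - b))"
    by (simp add: power2_eq_square algebra_simps)
  then show ?thesis using assms by simp
qed

lemma square_split_less:
  fixes a b c :: real
  assumes "a < b" "b < c"
  shows "(b - a)\<^sup>2 + (c - b)\<^sup>2 < (c - a)\<^sup>2"
proof -
  have "(c - a)\<^sup>2 = (b - a)\<^sup>2 + (c - b)\<^sup>2 + 2 * ((b - a) * (c - b))"
    by (simp add: power2_eq_square algebra_simps)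
  then show ?thesis using assms by simp
qed

lemma square_sum_abs:
  fixes a b :: real
  shows "(\<bar>a\<bar> - \<bar>b\<bar>)\<^sup>2 \<le> (a + b)\<^sup>2"
  by (simp add: abs_le_square_iff[symmetric])

lemma square_sum_abs_pos:
  fixes a b c :: real
  assumes "c \<le> a * b" "0 \<le> c"
  shows "(\<bar>a\<bar> - \<bar>b\<bar>)\<^sup>2 + 4 * c \<le> (a + b)\<^sup>2"
proof -
  have "\<bar>a\<bar> * \<bar>b\<bar> = a * b" using assms by (simp add: abs_mult[symmetric])
  moreover have "(\<bar>a\<bar> - \<bar>b\<bar>)\<^sup>2 = a\<^sup>2 + b\<^sup>2 - 2 * (\<bar>a\<bar> * \<bar>b\<bar>)" by (simp add: power2_eq_square algebra_simps)
  ultimately show ?thesis using assms by (simp add: power2_eq_square algebra_simps)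
qed

text \<open>The polar form of \<open>kite_form\<close>, needed for the stationarity equations of a minimiser.\<close>

definition kite_bilin :: "nat \<Rightarrow> nat \<Rightarrow> (nat \<Rightarrow> real) \<Rightarrow> (nat \<Rightarrow> real) \<Rightarrow> real" where
  "kite_bilin n m w d = (w 0 + w 1) * (d 0 + d 1) + (w 2 - w 0) * (d 2 - d 0) + (w 2 - w 1) * (d 2 - d 1) +
     (\<Sum>i = 2..<m - 1. (w (Suc i) - w i) * (d (Suc i) - d i)) +
     (\<Sum>j = m..<n. (w j - w (m - 1)) * (d j - d (m - 1)))"

lemma kite_form_add:
  "kite_form n m (\<lambda>i. w i + t * d i) = kite_form n m w + 2 * t * kite_bilin n m w d + t\<^sup>2 * kite_form n m d"
proof -
  have sq: "(a + t * b)\<^sup>2 = a\<^sup>2 + 2 * t * (a * b) + t\<^sup>2 * b\<^sup>2" for a b :: real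
    by (simp add: power2_eq_square algebra_simps)
  have diff: "(a + t * b) - (a' + t * b') = (a - a') + t * (b - b')" for a b a' b' :: real
    by (simp add: algebra_simps)
  have plus: "(a + t * b) + (a' + t * b') = (a + a') + t * (b + b')" for a b a' b' :: real
    by (simp add: algebra_simps)
  have sums: "(\<Sum>i\<in>A. (a i)\<^sup>2 + 2 * t * (a i * b i) + t\<^sup>2 * (b i)\<^sup>2) =
      (\<Sum>i\<in>A. (a i)\<^sup>2) + 2 * t * (\<Sum>i\<in>A. a i * b i) + t\<^sup>2 * (\<Sum>i\<in>A. (b i)\<^sup>2)" for A :: "nat set" and a b
    by (simp add: sum.distrib sum_distrib_left)
  show ?thesis unfolding kite_form_def kite_bilin_def diff plus sq sums
    by (simp add: distrib_left)
qed

lemma linear_coefficient_zero: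
  fixes a b :: real
  assumes "\<And>t. 0 \<le> 2 * t * b + t\<^sup>2 * a"
  shows "b = 0"
proof (rule ccontr)
  assume b: "b \<noteq> 0"
  \<comment> \<open>With \<open>1 + \<bar>a\<bar>\<close> for \<open>a\<close> the quadratic in \<open>t\<close> becomes negative at its vertex.\<close>
  define t where "t = - b / (1 + \<bar>a\<bar>)"
  have "2 * t * b + t\<^sup>2 * a \<le> 2 * t * b + t\<^sup>2 * (1 + \<bar>a\<bar>)" by (intro add_left_mono mult_left_mono) auto
  also have "t\<^sup>2 * (1 + \<bar>a\<bar>) = - t * b" by (simp add: t_def power2_eq_square divide_simps)
  also have "2 * t * b + - t * b = - (b\<^sup>2 / (1 + \<bar>a\<bar>))" by (simp add: t_def power2_eq_square)
  also have "\<dots> < 0" using b by (simp add: divide_pos_pos add_pos_nonneg)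
  finally show False using assms[of t] by linarith
qed

lemma kite_form_stationary:
  assumes form: "\<And>w. lam * (\<Sum>i<n. (w i)\<^sup>2) \<le> kite_form n m w"
    and min: "kite_form n m w = lam * (\<Sum>i<n. (w i)\<^sup>2)"
  shows "kite_bilin n m w d = lam * (\<Sum>i<n. w i * d i)"
proof -
  have "0 \<le> 2 * t * (kite_bilin n m w d - lam * (\<Sum>i<n. w i * d i)) +
      t\<^sup>2 * (kite_form n m d - lam * (\<Sum>i<n. (d i)\<^sup>2))" for t
  proof -
    have "(\<Sum>i<n. (w i + t * d i)\<^sup>2) = (\<Sum>i<n. (w i)\<^sup>2) + 2 * t * (\<Sum>i<n. w i * d i) + t\<^sup>2 * (\<Sum>i<n. (d i)\<^sup>2)"
    proof -
      have "(w i + t * d i)\<^sup>2 = (w i)\<^sup>2 + 2 * t * (w i * d i) + t\<^sup>2 * (d i)\<^sup>2" for i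
        by (simp add: power2_eq_square algebra_simps)
      then show ?thesis by (simp add: sum.distrib sum_distrib_left)
    qed
    then show ?thesis using form[of "\<lambda>i. w i + t * d i"] min
      by (simp add: kite_form_add algebra_simps)
  qed
  then have "kite_bilin n m w d - lam * (\<Sum>i<n. w i * d i) = 0" by (rule linear_coefficient_zero)
  then show ?thesis by simp
qed

text \<open>Testing the stationarity condition with the indicator of a final segment isolates a single gap.\<close>

lemma kite_bilin_tail:
  assumes "3 \<le> k" "k < m"
  shows "kite_bilin n m w (\<lambda>i. of_bool (k \<le> i)) = w k - w (k - 1)"
proof -
  have "(\<Sum>i = 2..<m - 1. (w (Suc i) - w i) * (of_bool (k \<le> Suc i) - of_bool (k \<le> i)))
      = (\<Sum>i = 2..<m - 1. if i = k - 1 then w (Suc i) - w i else 0)"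
    using assms by (intro sum.cong) auto
  also have "\<dots> = w k - w (k - 1)" using assms by (subst sum.delta) auto
  finally show ?thesis using assms by (simp add: kite_bilin_def)
qed

lemma kite_bilin_tail2:
  assumes "3 \<le> m"
  shows "kite_bilin n m w (\<lambda>i. of_bool (2 \<le> i)) = (w 2 - w 0) + (w 2 - w 1)"
  using assms by (simp add: kite_bilin_def)

lemma kite_bilin_swap:
  assumes "3 \<le> m"
  shows "kite_bilin n m w (\<lambda>i. of_bool (i = 0) - of_bool (i = 1)) = w 0 - w 1"
  using assms by (simp add: kite_bilin_def)

section \<open>Comparison along a sorted labelling\<close>

text \<open>
  A graph with edge set \<open>E\<close> on \<open>0, \<dots>, n - 1\<close> whose connected nonbipartite part is \<open>0, \<dots>, m - 1\<close>. The
  vertices \<open>0\<close> and \<open>1\<close> play the roles of \<open>a\<close> and \<open>b\<close> above, \<open>e0\<close> is an edge whose ends have equal signs,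
  and \<open>f v\<close> is a neighbour of the outer vertex \<open>v\<close>. The assumption \<open>cross\<close>, that every gap
  is bridged, expresses the connectedness of this part.
\<close>

locale sorted_labelling =
  fixes n m :: nat and E :: "nat rel" and x :: "nat \<Rightarrow> real" and p q :: nat
    and e0 :: "nat \<times> nat" and f :: "nat \<Rightarrow> nat"
  assumes m3: "3 \<le> m" and mn: "m \<le> n"
    and E_sub: "E \<subseteq> {(i, j). i < j \<and> j < n}"
    and e01: "(0, 1) \<in> E"
    and e0p: "(0, p) \<in> E" "2 \<le> p" "p < m"
    and e1q: "(1, q) \<in> E" "2 \<le> q" "q < m"
    and e0: "e0 \<in> E" "snd e0 < m" "\<bar>x 0\<bar> * \<bar>x 1\<bar> \<le> x (fst e0) * x (snd e0)"
    and x01: "\<bar>x 0\<bar> \<le> \<bar>x 1\<bar>" and x1p: "\<bar>x 1\<bar> \<le> \<bar>x p\<bar>"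
    and sorted: "\<And>i. 2 \<le> i \<Longrightarrow> Suc i < m \<Longrightarrow> max \<bar>x i\<bar> \<bar>x 1\<bar> \<le> max \<bar>x (Suc i)\<bar> \<bar>x 1\<bar>"
    and cross: "\<And>i. 2 \<le> i \<Longrightarrow> Suc i < m \<Longrightarrow> \<exists>u v. (u, v) \<in> E \<and> u \<le> i \<and> i < v \<and> v < m"
    and f: "\<And>v. m \<le> v \<Longrightarrow> v < n \<Longrightarrow> f v < m \<and> (f v, v) \<in> E"
begin

text \<open>
  The values of the comparison vector on the core. All entries except the first are raised to at least
  \<open>\<bar>x 1\<bar>\<close>, so that position \<open>1\<close> carries the least of them. This cannot decrease the norm, and the squares charged to
  an edge for differences of raised values are still bounded by its contribution (\<open>share_le\<close>).
\<close>

definition z :: "nat \<Rightarrow> real" where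
  "z i = (if i = 0 then \<bar>x 0\<bar> else max \<bar>x i\<bar> \<bar>x 1\<bar>)"

definition gap :: "nat \<Rightarrow> real" where
  "gap i = (z (Suc i) - z i)\<^sup>2"

text \<open>The part of the form of \<open>Cstar\<close> that is charged to the edge \<open>uv\<close>: all gaps that it bridges from the
  position \<open>2\<close> on, and for the edges \<open>01\<close>, \<open>0p\<close> and \<open>1q\<close> also one edge of the triangle.\<close>

definition share :: "nat \<Rightarrow> nat \<Rightarrow> real" where
  "share u v = (\<Sum>i = max 2 u..<v. gap i) + of_bool ((u, v) = (0, 1)) * (z 1 - z 0)\<^sup>2
     + of_bool ((u, v) = (0, p)) * (z 2 - z 0)\<^sup>2 + of_bool ((u, v) = (1, q)) * (z 2 - z 1)\<^sup>2"

text \<open>The part of \<open>kite_form\<close> without the pendant vertices, at \<open>z\<close>.\<close>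

definition core :: real where
  "core = (z 0 + z 1)\<^sup>2 + (z 2 - z 0)\<^sup>2 + (z 2 - z 1)\<^sup>2 + (\<Sum>i = 2..<m - 1. gap i)"

text \<open>What an edge is charged in total. Among the edges at an outer vertex \<open>v\<close> only the one from \<open>f v\<close> is
  used.\<close>

definition bound :: "nat \<times> nat \<Rightarrow> real" where
  "bound e = (case e of (u, v) \<Rightarrow> if v < m then share u v + of_bool (e = e0) * (4 * z 0 * z 1)
     else of_bool (u = f v) * (x u + x v)\<^sup>2)"

abbreviation (input) "M \<equiv> z (m - 1)"

lemma finite_E: "finite E"
proof (rule finite_subset)
  show "E \<subseteq> {..<n} \<times> {..<n}" using E_sub by auto
qed simp

lemma z0: "z 0 = \<bar>x 0\<bar>" and z1: "z 1 = \<bar>x 1\<bar>" "z (Suc 0) = \<bar>x (Suc 0)\<bar>"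
  by (auto simp: z_def)

lemma z_ge_abs: "\<bar>x i\<bar> \<le> z i" by (auto simp: z_def)

lemma z_nonneg: "0 \<le> z i" using z_ge_abs[of i] by linarith

lemma z_Suc: "2 \<le> i \<Longrightarrow> Suc i < m \<Longrightarrow> z i \<le> z (Suc i)"
  using sorted[of i] by (auto simp: z_def)

lemma z_mono: "2 \<le> i \<Longrightarrow> i \<le> j \<Longrightarrow> j < m \<Longrightarrow> z i \<le> z j"
  using sum_gaps_le[of i j z] z_Suc by auto

lemma gap_nonneg: "0 \<le> gap i" by (simp add: gap_def)

lemma sum_gap_le: "2 \<le> i \<Longrightarrow> i \<le> j \<Longrightarrow> j < m \<Longrightarrow> (\<Sum>k = i..<j. gap k) \<le> (z j - z i)\<^sup>2"
  using sum_gaps_le[of i j z] z_Suc unfolding gap_def by auto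

lemma z_ge_z1: "1 \<le> i \<Longrightarrow> z 1 \<le> z i" by (auto simp: z_def)

lemma z0_le_z1: "z 0 \<le> z 1" using x01 by (simp add: z_def)

lemma z_le_M: "i < m \<Longrightarrow> z i \<le> M"
proof -
  assume i: "i < m"
  have "z 1 \<le> M" using m3 by (intro z_ge_z1) auto
  moreover have "i = 0 \<or> i = 1 \<or> 2 \<le> i" by auto
  ultimately show ?thesis using z0_le_z1 z_mono[of i "m - 1"] i m3 by auto
qed

text \<open>If \<open>v\<close> was raised, then its value is the least one and the gaps between \<open>2\<close> and \<open>v\<close> are zero. Otherwise
  these gaps lie between \<open>\<bar>x u\<bar>\<close> and \<open>\<bar>x v\<bar>\<close>.\<close>

lemma sum_gap_le_low:
  assumes "u < 2" "2 \<le> v" "v < m"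
  shows "(\<Sum>k = 2..<v. gap k) \<le> (\<bar>x u\<bar> - \<bar>x v\<bar>)\<^sup>2"
proof -
  have u: "\<bar>x u\<bar> \<le> z 1" using assms(1) x01 by (cases u) (auto simp: z1 less_Suc_eq)
  have 1: "(\<Sum>k = 2..<v. gap k) \<le> (z v - z 2)\<^sup>2" using assms by (intro sum_gap_le) auto
  show ?thesis
  proof (cases "\<bar>x v\<bar> < z 1")
    case True
    then have "z v = z 1" using assms by (auto simp: z_def)
    then have "z v = z 2" using z_mono[of 2 v] z_ge_z1[of 2] assms by auto
    then show ?thesis using 1 by (smt (verit) power2_less_eq_zero_iff zero_le_power2)
  next
    case False
    then have "z v = \<bar>x v\<bar>" using assms by (auto simp: z_def)
    moreover have "z 2 \<le> z v" "z 1 \<le> z 2" using z_mono[of 2 v] z_ge_z1[of 2] assms by auto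
    ultimately have "(z v - z 2)\<^sup>2 \<le> (\<bar>x v\<bar> - \<bar>x u\<bar>)\<^sup>2" using u by (intro power_mono) auto
    then show ?thesis using 1 by (simp add: power2_commute)
  qed
qed

text \<open>Along an edge inside \<open>2, \<dots>, m - 1\<close> the raising is a contraction. For \<open>0p\<close> the bound \<open>\<bar>x 1\<bar> \<le> \<bar>x p\<bar>\<close> makes
  \<open>p\<close> a vertex that was not raised; if \<open>q\<close> was raised then \<open>z 2 = z 1\<close>, and the triangle edge charged to
  \<open>1q\<close> is free.\<close>

lemma share_le:
  assumes "(u, v) \<in> E" "v < m"
  shows "share u v \<le> (\<bar>x u\<bar> - \<bar>x v\<bar>)\<^sup>2"
proof -
  have uv: "u < v" using assms E_sub by auto
  consider "u = 0" "v = 1" | "u = 0" "2 \<le> v" "v = p" | "u = 0" "2 \<le> v" "v \<noteq> p"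
    | "u = 1" "2 \<le> v" "v = q" | "u = 1" "2 \<le> v" "v \<noteq> q" | "2 \<le> u" using uv by linarith
  then show ?thesis
  proof cases
    case 1
    then show ?thesis using e0p by (simp add: share_def z0 z1 power2_commute)
  next
    case 2
    have zp: "z p = \<bar>x p\<bar>" using x1p e0p by (simp add: z_def)
    have "(z 2 - z 0)\<^sup>2 + (z p - z 2)\<^sup>2 \<le> (z p - z 0)\<^sup>2"
      using z0_le_z1 z_ge_z1[of 2] z_mono[of 2 p] e0p by (intro square_split_le) auto
    moreover have "(\<Sum>i = 2..<p. gap i) \<le> (z p - z 2)\<^sup>2" using e0p by (intro sum_gap_le) auto
    ultimately show ?thesis using 2 zp z0 by (simp add: share_def power2_commute)
  next
    case 3
    then show ?thesis using sum_gap_le_low[of u v] assms by (simp add: share_def)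
  next
    case 4
    show ?thesis
    proof (cases "\<bar>x q\<bar> < z 1")
      case True
      then have "z q = z 1" using e1q by (auto simp: z_def)
      then have "z 2 = z 1" using z_mono[of 2 q] z_ge_z1[of 2] e1q by auto
      then show ?thesis using 4 sum_gap_le_low[of u v] assms by (simp add: share_def max_def)
    next
      case False
      then have zq: "z q = \<bar>x q\<bar>" using e1q by (auto simp: z_def)
      have "(z 2 - z 1)\<^sup>2 + (z q - z 2)\<^sup>2 \<le> (z q - z 1)\<^sup>2"
        using z_ge_z1[of 2] z_mono[of 2 q] e1q by (intro square_split_le) auto
      moreover have "(\<Sum>i = 2..<q. gap i) \<le> (z q - z 2)\<^sup>2" using e1q by (intro sum_gap_le) auto
      ultimately show ?thesis using 4 zq z1 by (simp add: share_def max_def power2_commute)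
    qed
  next
    case 5
    then show ?thesis using sum_gap_le_low[of u v] assms by (simp add: share_def max_def)
  next
    case 6
    have "share u v = (\<Sum>i = u..<v. gap i)" using 6 by (simp add: share_def max_def)
    also have "\<dots> \<le> (z v - z u)\<^sup>2" using 6 assms uv by (intro sum_gap_le) auto
    also have "\<dots> \<le> (\<bar>x u\<bar> - \<bar>x v\<bar>)\<^sup>2"
    proof (rule abs_le_square_iff[THEN iffD1])
      have "\<bar>max a c - max b c\<bar> \<le> \<bar>b - a\<bar>" for a b c :: real by (simp add: max_def abs_minus_commute)
      then show "\<bar>z v - z u\<bar> \<le> \<bar>\<bar>x u\<bar> - \<bar>x v\<bar>\<bar>" using 6 uv by (simp add: z_def)
    qed
    finally show ?thesis .
  qed
qed

lemma edge_square_ge: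
  assumes "(u, v) \<in> E"
  shows "(\<bar>x u\<bar> - \<bar>x v\<bar>)\<^sup>2 + of_bool ((u, v) = e0) * (4 * z 0 * z 1) \<le> (x u + x v)\<^sup>2"
proof (cases "(u, v) = e0")
  case True
  have "z 0 * z 1 \<le> x u * x v" using e0 unfolding True[symmetric] by (simp add: z0 z1)
  then have "(\<bar>x u\<bar> - \<bar>x v\<bar>)\<^sup>2 + 4 * (z 0 * z 1) \<le> (x u + x v)\<^sup>2"
    using z_nonneg by (intro square_sum_abs_pos) auto
  then show ?thesis using True by simp
next
  case False
  then show ?thesis using square_sum_abs[of "x u" "x v"] by simp
qed

lemma bound_le:
  assumes "(u, v) \<in> E"
  shows "bound (u, v) \<le> (x u + x v)\<^sup>2"
proof (cases "v < m")
  case True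
  then show ?thesis using edge_square_ge[OF assms] share_le[OF assms True] by (simp add: bound_def)
qed (auto simp: bound_def)

text \<open>Double counting: every gap is charged to at least one edge that bridges it.\<close>

lemma sum_share:
  "(z 1 - z 0)\<^sup>2 + (z 2 - z 0)\<^sup>2 + (z 2 - z 1)\<^sup>2 + (\<Sum>i = 2..<m - 1. gap i)
     \<le> (\<Sum>(u, v)\<in>{(u, v)\<in>E. v < m}. share u v)"
proof -
  define S where "S = {(u, v)\<in>E. v < m}"
  have fin: "finite S" using finite_E unfolding S_def by (rule rev_finite_subset) auto
  have in_S: "(0, 1) \<in> S" "(0, p) \<in> S" "(1, q) \<in> S" using e01 e0p e1q m3 by (auto simp: S_def)
  have single: "(\<Sum>(u, v)\<in>S. of_bool ((u, v) = e) * c) = c" if "e \<in> S" for e and c :: real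
  proof -
    have "(\<Sum>(u, v)\<in>S. of_bool ((u, v) = e) * c) = (\<Sum>e'\<in>S. if e' = e then c else 0)"
      by (intro sum.cong) auto
    then show ?thesis using that fin by simp
  qed
  have "(\<Sum>i = 2..<m - 1. gap i) \<le> (\<Sum>i = 2..<m - 1. \<Sum>(u, v)\<in>S. of_bool (u \<le> i \<and> i < v) * gap i)"
  proof (rule sum_mono)
    fix i assume "i \<in> {2..<m - 1}"
    then obtain u v where uv: "(u, v) \<in> S" "u \<le> i" "i < v" using cross[of i] unfolding S_def by fastforce
    have "gap i = (case (u, v) of (u, v) \<Rightarrow> of_bool (u \<le> i \<and> i < v) * gap i)" using uv by simp
    also have "\<dots> \<le> (\<Sum>(u, v)\<in>S. of_bool (u \<le> i \<and> i < v) * gap i)"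
      using fin uv(1) by (intro member_le_sum) (auto simp: gap_nonneg)
    finally show "gap i \<le> (\<Sum>(u, v)\<in>S. of_bool (u \<le> i \<and> i < v) * gap i)" .
  qed
  also have "\<dots> = (\<Sum>(u, v)\<in>S. \<Sum>i = 2..<m - 1. of_bool (u \<le> i \<and> i < v) * gap i)"
    unfolding case_prod_unfold by (rule sum.swap)
  also have "\<dots> = (\<Sum>(u, v)\<in>S. \<Sum>i = max 2 u..<v. gap i)"
  proof (rule sum.cong, simp, clarify)
    fix u v assume "(u, v) \<in> S"
    then have v: "v < m" by (auto simp: S_def)
    have "(\<Sum>i = max 2 u..<v. gap i) = (\<Sum>i = max 2 u..<v. of_bool (u \<le> i \<and> i < v) * gap i)"
      by (intro sum.cong) auto
    also have "\<dots> = (\<Sum>i = 2..<m - 1. of_bool (u \<le> i \<and> i < v) * gap i)"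
      using v by (intro sum.mono_neutral_left) auto
    finally show "(\<Sum>i = 2..<m - 1. of_bool (u \<le> i \<and> i < v) * gap i) = (\<Sum>i = max 2 u..<v. gap i)" by simp
  qed
  finally have "(\<Sum>i = 2..<m - 1. gap i) \<le> (\<Sum>(u, v)\<in>S. \<Sum>i = max 2 u..<v. gap i)" .
  moreover have "(\<Sum>(u, v)\<in>S. share u v) = (\<Sum>(u, v)\<in>S. \<Sum>i = max 2 u..<v. gap i)
      + (\<Sum>(u, v)\<in>S. of_bool ((u, v) = (0, 1)) * (z 1 - z 0)\<^sup>2)
      + (\<Sum>(u, v)\<in>S. of_bool ((u, v) = (0, p)) * (z 2 - z 0)\<^sup>2)
      + (\<Sum>(u, v)\<in>S. of_bool ((u, v) = (1, q)) * (z 2 - z 1)\<^sup>2)"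
    unfolding share_def case_prod_unfold by (simp add: sum.distrib)
  ultimately show ?thesis using single[OF in_S(1)] single[OF in_S(2)] single[OF in_S(3)]
    unfolding S_def[symmetric] by simp
qed

lemma sum_bound:
  "core + (\<Sum>v = m..<n. (x (f v) + x v)\<^sup>2) \<le> sum bound E"
proof -
  define S where "S = {(u, v)\<in>E. v < m}"
  define L where "L = {(u, v)\<in>E. m \<le> v}"
  have fin: "finite S" "finite L" using finite_E unfolding S_def L_def by (auto intro: rev_finite_subset)
  have "E = S \<union> L" "S \<inter> L = {}" by (auto simp: S_def L_def)
  then have "sum bound E = sum bound S + sum bound L" using fin by (simp add: sum.union_disjoint)
  moreover have "core \<le> sum bound S"
  proof -
    have "sum bound S = (\<Sum>(u, v)\<in>S. share u v) + (\<Sum>e\<in>S. if e = e0 then 4 * z 0 * z 1 else 0)"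
      unfolding sum.distrib[symmetric] by (intro sum.cong) (auto simp: bound_def S_def)
    moreover have "(\<Sum>e\<in>S. if e = e0 then 4 * z 0 * z 1 else 0) = 4 * z 0 * z 1"
      using e0 fin by (auto simp: S_def case_prod_unfold)
    moreover have "(z 0 + z 1)\<^sup>2 = (z 1 - z 0)\<^sup>2 + 4 * z 0 * z 1"
      by (simp add: power2_eq_square algebra_simps)
    ultimately show ?thesis using sum_share by (simp add: core_def S_def)
  qed
  moreover have "(\<Sum>v = m..<n. (x (f v) + x v)\<^sup>2) \<le> sum bound L"
  proof -
    have "(\<Sum>v = m..<n. (x (f v) + x v)\<^sup>2) = (\<Sum>v = m..<n. bound (f v, v))"
      by (intro sum.cong) (auto simp: bound_def)
    also have "\<dots> = sum bound ((\<lambda>v. (f v, v)) ` {m..<n})"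
      by (subst sum.reindex) (auto simp: inj_on_def)
    also have "\<dots> \<le> sum bound L"
      using fin f by (intro sum_mono2) (auto simp: L_def bound_def)
    finally show ?thesis .
  qed
  ultimately show ?thesis by linarith
qed

end

text \<open>
  From here on \<open>lam\<close> is a lower bound for the quotient of \<open>kite_form\<close>; it will be the least eigenvalue
  of \<open>Cstar n 3 (m - 3)\<close>.
\<close>

locale kite_comparison = sorted_labelling +
  fixes lam :: real
  assumes lam: "0 < lam" "lam < 1"
    and form: "\<And>w. lam * (\<Sum>i<n. (w i)\<^sup>2) \<le> kite_form n m w"
begin

text \<open>The pendant value \<open>M / (1 - lam)\<close> minimises \<open>(t - M)\<^sup>2 - lam * t\<^sup>2\<close>.\<close>

definition w :: "nat \<Rightarrow> real" where
  "w i = (if i < m then z i else M / (1 - lam))"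

lemma kite_form_w:
  "kite_form n m w - lam * (\<Sum>i<n. (w i)\<^sup>2) =
     core - (lam * (\<Sum>i<m. (z i)\<^sup>2) + real (n - m) * (lam / (1 - lam) * M\<^sup>2))"
proof -
  define c where "c = 1 / (1 - lam)"
  have w_def: "w i = (if i < m then z i else c * M)" for i by (simp add: c_def w_def)
  have w: "w i = z i" if "i < m" for i using that by (simp add: w_def)
  have "(\<Sum>i = 2..<m - 1. (w (Suc i) - w i)\<^sup>2) = (\<Sum>i = 2..<m - 1. gap i)"
    by (intro sum.cong) (auto simp: w gap_def)
  moreover have "(\<Sum>j = m..<n. (w j - w (m - 1))\<^sup>2) = real (n - m) * (c * M - M)\<^sup>2"
    using m3 by (simp add: w_def)
  ultimately have k: "kite_form n m w = core + real (n - m) * (c * M - M)\<^sup>2"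
    using m3 by (simp add: kite_form_def core_def w)
  have "{..<n} = {..<m} \<union> {m..<n}" using mn by auto
  then have "(\<Sum>i<n. (w i)\<^sup>2) = (\<Sum>i<m. (w i)\<^sup>2) + (\<Sum>i=m..<n. (w i)\<^sup>2)"
    by (simp add: sum.union_disjoint ivl_disj_int)
  also have "\<dots> = (\<Sum>i<m. (z i)\<^sup>2) + real (n - m) * (c * M)\<^sup>2" by (simp add: w_def)
  finally have s: "(\<Sum>i<n. (w i)\<^sup>2) = (\<Sum>i<m. (z i)\<^sup>2) + real (n - m) * (c * M)\<^sup>2" .
  have "lam * (c * M)\<^sup>2 - (c * M - M)\<^sup>2 = lam / (1 - lam) * M\<^sup>2"
  proof -
    have "lam * c\<^sup>2 - (c - 1)\<^sup>2 = lam / (1 - lam)"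
    proof -
      have "c * (1 - lam) = 1" using lam by (simp add: c_def)
      then have c1: "c - 1 = lam * c" by (simp add: algebra_simps)
      have "lam * c\<^sup>2 - (c - 1)\<^sup>2 = lam * c * (c * (1 - lam))"
        unfolding c1 by (simp add: power2_eq_square algebra_simps)
      then have "lam * c\<^sup>2 - (c - 1)\<^sup>2 = lam * c" by (simp add: \<open>c * (1 - lam) = 1\<close>)
      then show ?thesis by (simp add: c_def)
    qed
    moreover have "lam * (c * M)\<^sup>2 - (c * M - M)\<^sup>2 = (lam * c\<^sup>2 - (c - 1)\<^sup>2) * M\<^sup>2"
      by (simp add: power2_eq_square algebra_simps)
    ultimately show ?thesis by simp
  qed
  then have "real (n - m) * (lam / (1 - lam) * M\<^sup>2) = lam * (real (n - m) * (c * M)\<^sup>2) - real (n - m) * (c * M - M)\<^sup>2"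
    by (metis mult.left_commute right_diff_distrib)
  then show ?thesis unfolding k s by (simp add: distrib_left)
qed

lemma core_ge: "lam * (\<Sum>i<m. (z i)\<^sup>2) + real (n - m) * (lam / (1 - lam) * M\<^sup>2) \<le> core"
  using kite_form_w form[of w] by linarith

text \<open>Completing the square in \<open>b\<close>, so that the best value of an outer vertex becomes visible.\<close>

lemma leaf_square:
  fixes a b :: real
  shows "(a + b)\<^sup>2 = lam * b\<^sup>2 - lam / (1 - lam) * a\<^sup>2 + (1 - lam) * (b + a / (1 - lam))\<^sup>2"
proof -
  have "1 - lam \<noteq> 0" using lam by simp
  then show ?thesis by (simp add: divide_simps) (simp add: power2_eq_square algebra_simps)
qed

lemma square_le_z: "(x i)\<^sup>2 \<le> (z i)\<^sup>2"
  using z_ge_abs[of i] z_nonneg[of i] by (metis abs_le_square_iff abs_of_nonneg)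

lemma leaf_le: "i < m \<Longrightarrow> (x i)\<^sup>2 \<le> M\<^sup>2"
  using square_le_z[of i] z_le_M[of i] z_nonneg[of i] power_mono[of "z i" M 2] by linarith

text \<open>
  The excess of the form over \<open>lam\<close> times the squared norm, written as a sum of six terms that are
  nonnegative each. The inequality follows at once, and in the case of equality all six terms vanish.
\<close>

lemma energy_decomposition:
  "energy E x - lam * (\<Sum>i<n. (x i)\<^sup>2) =
     (\<Sum>(u, v)\<in>E. (x u + x v)\<^sup>2 - bound (u, v))
   + (sum bound E - core - (\<Sum>v = m..<n. (x (f v) + x v)\<^sup>2))
   + (\<Sum>v = m..<n. (1 - lam) * (x v + x (f v) / (1 - lam))\<^sup>2)
   + (\<Sum>v = m..<n. lam / (1 - lam) * (M\<^sup>2 - (x (f v))\<^sup>2))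
   + (core - (lam * (\<Sum>i<m. (z i)\<^sup>2) + real (n - m) * (lam / (1 - lam) * M\<^sup>2)))
   + lam * (\<Sum>i<m. (z i)\<^sup>2 - (x i)\<^sup>2)"
proof -
  have "(\<Sum>(u, v)\<in>E. (x u + x v)\<^sup>2 - bound (u, v)) = energy E x - sum bound E"
    by (simp add: energy_def case_prod_unfold sum_subtractf)
  moreover have "{..<n} = {..<m} \<union> {m..<n}" using mn by auto
  then have "(\<Sum>i<n. (x i)\<^sup>2) = (\<Sum>i<m. (x i)\<^sup>2) + (\<Sum>i=m..<n. (x i)\<^sup>2)"
    by (simp add: sum.union_disjoint ivl_disj_int)
  moreover have "(\<Sum>v = m..<n. (x (f v) + x v)\<^sup>2) = lam * (\<Sum>v = m..<n. (x v)\<^sup>2)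
      - (\<Sum>v = m..<n. lam / (1 - lam) * (x (f v))\<^sup>2) + (\<Sum>v = m..<n. (1 - lam) * (x v + x (f v) / (1 - lam))\<^sup>2)"
  proof -
    have "(\<Sum>v = m..<n. (x (f v) + x v)\<^sup>2) = (\<Sum>v = m..<n. lam * (x v)\<^sup>2
        - lam / (1 - lam) * (x (f v))\<^sup>2 + (1 - lam) * (x v + x (f v) / (1 - lam))\<^sup>2)"
      by (rule sum.cong[OF refl], rule leaf_square)
    then show ?thesis by (simp only: sum.distrib sum_subtractf sum_distrib_left)
  qed
  moreover have "(\<Sum>v = m..<n. lam / (1 - lam) * (M\<^sup>2 - (x (f v))\<^sup>2)) =
      real (n - m) * (lam / (1 - lam) * M\<^sup>2) - (\<Sum>v = m..<n. lam / (1 - lam) * (x (f v))\<^sup>2)"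
    by (simp only: sum_subtractf right_diff_distrib sum_constant card_atLeastLessThan)
  ultimately show ?thesis by (simp add: sum_subtractf right_diff_distrib distrib_left)
qed

lemma decomposition_nonneg:
  "0 \<le> (\<Sum>(u, v)\<in>E. (x u + x v)\<^sup>2 - bound (u, v))"
  "0 \<le> sum bound E - core - (\<Sum>v = m..<n. (x (f v) + x v)\<^sup>2)"
  "0 \<le> (\<Sum>v = m..<n. (1 - lam) * (x v + x (f v) / (1 - lam))\<^sup>2)"
  "0 \<le> (\<Sum>v = m..<n. lam / (1 - lam) * (M\<^sup>2 - (x (f v))\<^sup>2))"
  "0 \<le> core - (lam * (\<Sum>i<m. (z i)\<^sup>2) + real (n - m) * (lam / (1 - lam) * M\<^sup>2))"
  "0 \<le> lam * (\<Sum>i<m. (z i)\<^sup>2 - (x i)\<^sup>2)"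
proof -
  show "0 \<le> (\<Sum>(u, v)\<in>E. (x u + x v)\<^sup>2 - bound (u, v))"
    using bound_le by (intro sum_nonneg) auto
  show "0 \<le> sum bound E - core - (\<Sum>v = m..<n. (x (f v) + x v)\<^sup>2)" using sum_bound by linarith
  show "0 \<le> (\<Sum>v = m..<n. (1 - lam) * (x v + x (f v) / (1 - lam))\<^sup>2)" using lam by (intro sum_nonneg) auto
  show "0 \<le> (\<Sum>v = m..<n. lam / (1 - lam) * (M\<^sup>2 - (x (f v))\<^sup>2))"
    using lam f leaf_le by (intro sum_nonneg mult_nonneg_nonneg) auto
  show "0 \<le> core - (lam * (\<Sum>i<m. (z i)\<^sup>2) + real (n - m) * (lam / (1 - lam) * M\<^sup>2))" using core_ge by linarith
  show "0 \<le> lam * (\<Sum>i<m. (z i)\<^sup>2 - (x i)\<^sup>2)"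
    using lam square_le_z by (intro mult_nonneg_nonneg sum_nonneg) auto
qed

lemma energy_ge: "lam * (\<Sum>i<n. (x i)\<^sup>2) \<le> energy E x"
  using energy_decomposition decomposition_nonneg by linarith

end

section \<open>The equality case\<close>

locale extremal_labelling = kite_comparison +
  assumes extremal: "energy E x = lam * (\<Sum>i<n. (x i)\<^sup>2)"
    and nonzero: "\<exists>i<n. x i \<noteq> 0"
begin

lemma equalities:
  "(u, v) \<in> E \<Longrightarrow> bound (u, v) = (x u + x v)\<^sup>2"
  "m \<le> v \<Longrightarrow> v < n \<Longrightarrow> x v = - x (f v) / (1 - lam)"
  "m \<le> v \<Longrightarrow> v < n \<Longrightarrow> \<bar>x (f v)\<bar> = M"
  "kite_form n m w = lam * (\<Sum>i<n. (w i)\<^sup>2)"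
proof -
  have zero: "(\<Sum>(u, v)\<in>E. (x u + x v)\<^sup>2 - bound (u, v)) = 0"
    "(\<Sum>v = m..<n. (1 - lam) * (x v + x (f v) / (1 - lam))\<^sup>2) = 0"
    "(\<Sum>v = m..<n. lam / (1 - lam) * (M\<^sup>2 - (x (f v))\<^sup>2)) = 0"
    "core - (lam * (\<Sum>i<m. (z i)\<^sup>2) + real (n - m) * (lam / (1 - lam) * M\<^sup>2)) = 0"
    using energy_decomposition decomposition_nonneg extremal by linarith+
  show "bound (u, v) = (x u + x v)\<^sup>2" if "(u, v) \<in> E"
  proof -
    have "\<forall>e\<in>E. (case e of (u, v) \<Rightarrow> (x u + x v)\<^sup>2 - bound (u, v)) = 0"
      using zero(1) finite_E bound_le by (subst (asm) sum_nonneg_eq_0_iff) auto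
    then show ?thesis using that by fastforce
  qed
  show "x v = - x (f v) / (1 - lam)" if "m \<le> v" "v < n"
  proof -
    have "\<forall>v\<in>{m..<n}. (1 - lam) * (x v + x (f v) / (1 - lam))\<^sup>2 = 0"
      using zero(2) lam by (subst (asm) sum_nonneg_eq_0_iff) auto
    then have "(1 - lam) * (x v + x (f v) / (1 - lam))\<^sup>2 = 0" by (rule bspec) (use that in simp)
    then have "x v + x (f v) / (1 - lam) = 0" using lam by simp
    then show ?thesis by (simp add: eq_neg_iff_add_eq_0)
  qed
  show "\<bar>x (f v)\<bar> = M" if "m \<le> v" "v < n"
  proof -
    have "\<forall>v\<in>{m..<n}. lam / (1 - lam) * (M\<^sup>2 - (x (f v))\<^sup>2) = 0"
      using zero(3) lam leaf_le f by (subst (asm) sum_nonneg_eq_0_iff) auto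
    then have "lam / (1 - lam) * (M\<^sup>2 - (x (f v))\<^sup>2) = 0" by (rule bspec) (use that in simp)
    then have "M\<^sup>2 = (x (f v))\<^sup>2" using lam by simp
    then show ?thesis using z_nonneg by (metis abs_of_nonneg power2_abs power2_eq_iff_nonneg abs_ge_zero)
  qed
  show "kite_form n m w = lam * (\<Sum>i<n. (w i)\<^sup>2)" using kite_form_w zero(4) by linarith
qed

text \<open>If the values vanish on the core, then they vanish on the outer vertices too, which are multiples of values
  on the core.\<close>

lemma M_pos: "0 < M"
proof (rule ccontr)
  assume "\<not> 0 < M"
  then have "M = 0" using z_nonneg[of "m - 1"] by linarith
  then have small: "x i = 0" if "i < m" for i using z_le_M[OF that] z_ge_abs[of i] by linarith
  have "x i = 0" if "i < n" for i
    using equalities(2)[of i] small[of i] small[of "f i"] f[of i] that by (cases "i < m") auto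
  then show False using nonzero by auto
qed

lemma w_small: "i < m \<Longrightarrow> w i = z i" by (simp add: w_def)

lemma w_nonneg: "0 \<le> w i" using lam z_nonneg by (simp add: w_def)

text \<open>Every final segment contains the position \<open>m - 1\<close>, where the value is \<open>M > 0\<close>; together with
  \<open>stationary\<close> this makes every gap positive.\<close>

lemma tail_pos:
  assumes "k < m"
  shows "0 < lam * (\<Sum>i<n. w i * of_bool (k \<le> i))"
proof -
  have "0 < w (m - 1) * of_bool (k \<le> m - 1)" using assms M_pos m3 by (simp add: w_small)
  also have "\<dots> \<le> (\<Sum>i<n. w i * of_bool (k \<le> i))"
    using m3 mn w_nonneg by (intro member_le_sum[where f = "\<lambda>i. w i * of_bool (k \<le> i)"]) auto
  finally show ?thesis using lam by simp
qed

lemmas stationary = kite_form_stationary[OF form equalities(4)]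

text \<open>Stationarity in the direction that is \<open>1\<close> at \<open>0\<close> and \<open>-1\<close> at \<open>1\<close> gives
  \<open>z 0 - z 1 = lam * (z 0 - z 1)\<close>, and \<open>lam < 1\<close>.\<close>

lemma z0_eq_z1: "z 0 = z 1"
proof -
  have "w 0 - w 1 = lam * (\<Sum>i<n. w i * (of_bool (i = 0) - of_bool (i = 1)))"
    using stationary[of "\<lambda>i. of_bool (i = 0) - of_bool (i = 1)"] kite_bilin_swap[OF m3, of n w] by argo
  also have "(\<Sum>i<n. w i * (of_bool (i = 0) - of_bool (i = 1))) = (\<Sum>i<n. (if i = 0 then w 0 else 0) - (if i = 1 then w 1 else 0))"
    by (intro sum.cong) auto
  also have "\<dots> = w 0 - w 1" using m3 mn by (simp add: sum_subtractf)
  finally have "(1 - lam) * (w 0 - w 1) = 0" by (simp add: algebra_simps)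
  then have "w 0 = w 1" using lam by simp
  then show ?thesis using m3 by (simp add: w_small)
qed

lemma z1_less_z2: "z 1 < z 2"
proof -
  have "(w 2 - w 0) + (w 2 - w 1) = lam * (\<Sum>i<n. w i * of_bool (2 \<le> i))"
    using stationary[of "\<lambda>i. of_bool (2 \<le> i)"] kite_bilin_tail2[OF m3, of n w] by argo
  then have "0 < (w 2 - w 0) + (w 2 - w 1)" using tail_pos[of 2] m3 by simp
  then show ?thesis using z0_eq_z1 m3 by (simp add: w_small)
qed

lemma z_less_Suc:
  assumes "2 \<le> i" "Suc i < m"
  shows "z i < z (Suc i)"
proof -
  have "w (Suc i) - w (Suc i - 1) = lam * (\<Sum>j<n. w j * of_bool (Suc i \<le> j))"
    using stationary[of "\<lambda>j. of_bool (Suc i \<le> j)"] kite_bilin_tail[of "Suc i" m n w] assms by auto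
  then have "0 < w (Suc i) - w i" using tail_pos[of "Suc i"] assms by simp
  then show ?thesis using assms by (simp add: w_small)
qed

lemma z_less_M:
  assumes "i < m - 1"
  shows "z i < M"
proof -
  have "z j < M" if "2 \<le> j" "j < m - 1" for j
  proof -
    have "z (Suc j) \<le> M" using that by (intro z_le_M) auto
    moreover have "z j < z (Suc j)" using that by (intro z_less_Suc) auto
    ultimately show ?thesis by linarith
  qed
  moreover have "z 1 < M" using z1_less_z2 z_le_M[of 2] m3 by linarith
  moreover have "i = 0 \<or> i = 1 \<or> 2 \<le> i" by linarith
  ultimately show ?thesis using assms z0_eq_z1 by auto
qed

text \<open>No vertex was raised, since all values from position \<open>2\<close> on exceed \<open>z 1\<close> strictly.\<close>

lemma abs_eq_z:
  assumes "i < m"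
  shows "\<bar>x i\<bar> = z i"
proof (cases "2 \<le> i")
  case True
  then have "z 1 < z i" using z1_less_z2 z_mono[of 2 i] assms by auto
  then show ?thesis using True by (auto simp: z_def)
next
  case False
  then have "i = 0 \<or> i = 1" by auto
  then show ?thesis by (auto simp: z_def)
qed

lemma share_eq:
  assumes "(u, v) \<in> E" "v < m"
  shows "share u v = (z v - z u)\<^sup>2"
proof -
  have "u < m" using assms E_sub by auto
  moreover have "(\<bar>x u\<bar> - \<bar>x v\<bar>)\<^sup>2 \<le> share u v"
    using equalities(1)[OF assms(1)] edge_square_ge[OF assms(1)] assms by (simp add: bound_def)
  ultimately show ?thesis using share_le[OF assms] abs_eq_z assms by (simp add: power2_commute)
qed

text \<open>An edge from \<open>0\<close> or \<open>1\<close> past the position \<open>2\<close> would contribute strictly more than its share, by the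
  mixed product of two positive differences.\<close>

lemma low_edge:
  assumes "(u, v) \<in> E" "u < 2" "2 \<le> v" "v < m"
  shows "v = 2"
proof (rule ccontr)
  assume "v \<noteq> 2"
  then have v: "2 < v" using assms by simp
  have u: "z u = z 1" using z0_eq_z1 assms(2) by (cases u) (auto simp: less_Suc_eq)
  have "share u v \<le> (\<Sum>i = 2..<v. gap i) + (z 2 - z 1)\<^sup>2"
    using assms v e0p e1q z0_eq_z1 by (auto simp: share_def max_def of_bool_def)
  also have "\<dots> \<le> (z v - z 2)\<^sup>2 + (z 2 - z 1)\<^sup>2" using sum_gap_le[of 2 v] assms by simp
  also have "\<dots> < (z v - z 1)\<^sup>2"
  proof -
    have "z 2 < z v"
      using z_less_Suc[of 2] z_mono[of 3 v] v assms by (simp add: numeral_3_eq_3 numeral_2_eq_2)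
    then show ?thesis using square_split_less[of "z 1" "z 2" "z v"] z1_less_z2 by simp
  qed
  finally show False using share_eq[OF assms(1,4)] u by simp
qed

lemma high_edge:
  assumes "(u, v) \<in> E" "2 \<le> u" "v < m"
  shows "v = Suc u"
proof (rule ccontr)
  assume "v \<noteq> Suc u"
  moreover have "u < v" using assms E_sub by auto
  ultimately have uv: "Suc u < v" by simp
  have "share u v = (\<Sum>i = u..<v. gap i)" using assms by (simp add: share_def max_def)
  also have "\<dots> < (z v - z u)\<^sup>2"
    unfolding gap_def using uv assms z_less_Suc by (intro sum_gaps_less) auto
  finally show False using share_eq[OF assms(1,3)] by simp
qed

lemma leaf_support:
  assumes "m \<le> v" "v < n"
  shows "f v = m - 1"
proof (rule ccontr)
  assume "f v \<noteq> m - 1"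
  then have "z (f v) < M" using f[OF assms] by (intro z_less_M) auto
  then show False using equalities(3)[OF assms] z_ge_abs[of "f v"] by simp
qed

lemma abs_leaf:
  assumes "m \<le> v" "v < n"
  shows "M < \<bar>x v\<bar>"
proof -
  have "M * (1 - lam) < M" using M_pos lam by simp
  then have "M < M / (1 - lam)" using lam by (simp add: pos_less_divide_eq)
  then show ?thesis using equalities(2,3)[OF assms] lam by simp
qed

text \<open>
  All outer vertices carry the same nonzero value, of larger modulus than any value on the core. Hence an
  additional edge at one of them would contribute a positive amount, while it is charged nothing.
\<close>

lemma leaf_edge:
  assumes "(u, v) \<in> E" "m \<le> v"
  shows "u = m - 1"
proof (rule ccontr)
  assume u: "u \<noteq> m - 1"
  have uv: "u < v" "v < n" using assms E_sub by auto
  have "x u + x v = 0"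
    using equalities(1)[OF assms(1)] u leaf_support[OF assms(2) uv(2)] assms by (simp add: bound_def)
  moreover have "x u = x v" if "m \<le> u"
    using that equalities(2)[of u] equalities(2)[of v] leaf_support uv assms by simp
  moreover have "\<bar>x u\<bar> < \<bar>x v\<bar>" if "u < m"
    using abs_leaf[OF assms(2) uv(2)] z_le_M[OF that] z_ge_abs[of u] by linarith
  moreover have "0 < \<bar>x v\<bar>" using abs_leaf[OF assms(2) uv(2)] M_pos by linarith
  ultimately show False by (cases "u < m") auto
qed

lemma edges_sub: "E \<subseteq> kite_edges n m"
proof clarify
  fix u v assume uv: "(u, v) \<in> E"
  then have lt: "u < v" "v < n" using E_sub by auto
  show "(u, v) \<in> kite_edges n m"
  proof (cases "v < m")
    case True
    then have "v = 1 \<and> u = 0 \<or> v = 2 \<or> v = Suc u" "2 \<le> u \<longrightarrow> v = Suc u"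
      using low_edge[OF uv] high_edge[OF uv] lt by linarith+
    then show ?thesis using lt True by (auto simp: kite_edges_def)
  next
    case False
    then show ?thesis using leaf_edge[OF uv] lt by (simp add: kite_edges_def)
  qed
qed

lemma edges_eq: "E = kite_edges n m"
proof
  show "kite_edges n m \<subseteq> E"
  proof clarify
    fix u v assume "(u, v) \<in> kite_edges n m"
    then consider "u = 0" "v = 1" | "u < 2" "v = 2" | "2 \<le> u" "v = Suc u" "Suc u < m"
      | "u = m - 1" "m \<le> v" "v < n" by (auto simp: kite_edges_def)
    then show "(u, v) \<in> E"
    proof cases
      case 1
      then show ?thesis using e01 by simp
    next
      case 2
      then show ?thesis using low_edge[OF e0p(1)] low_edge[OF e1q(1)] e0p e1q by (auto simp: less_2_cases_iff)
    next
      case 3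
      then obtain u' v' where "(u', v') \<in> E" "u' \<le> u" "u < v'" "v' < m" using cross[of u] by auto
      moreover from this have "2 \<le> u'" using low_edge[of u' v'] 3 by (cases "2 \<le> u'") auto
      ultimately have "(u', v') \<in> E" "v' = Suc u'" "u' = u" using high_edge[of u' v'] by auto
      then show ?thesis using 3 by simp
    next
      case 4
      then show ?thesis using leaf_support[of v] f[of v] by simp
    qed
  qed
qed (rule edges_sub)

end

section \<open>Sorted labellings of nonbipartite graphs\<close>

text \<open>Connectedness of the subgraph induced by \<open>S\<close>, in the form in which it is used: no proper part of \<open>S\<close> is
  separated from the rest. The empty set counts as connected.\<close>

definition cut_connected :: "'a rel \<Rightarrow> 'a set \<Rightarrow> bool" where
  "cut_connected A S \<longleftrightarrow> (\<forall>T \<subset> S. T \<noteq> {} \<longrightarrow> (\<exists>u\<in>T. \<exists>v\<in>S - T. (u, v) \<in> A))"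

lemma cut_connectedD:
  "cut_connected A S \<Longrightarrow> T \<subset> S \<Longrightarrow> T \<noteq> {} \<Longrightarrow> \<exists>u\<in>T. \<exists>v\<in>S - T. (u, v) \<in> A"
  unfolding cut_connected_def by (drule spec, drule mp, assumption, drule mp, assumption)

definition colourable :: "'a rel \<Rightarrow> 'a set \<Rightarrow> bool" where
  "colourable A W \<longleftrightarrow> (\<exists>c :: 'a \<Rightarrow> bool. \<forall>u\<in>W. \<forall>v\<in>W. (u, v) \<in> A \<longrightarrow> c u \<noteq> c v)"

lemma colourableE:
  assumes "colourable A W"
  obtains c :: "'a \<Rightarrow> bool" where "\<And>u v. u \<in> W \<Longrightarrow> v \<in> W \<Longrightarrow> (u, v) \<in> A \<Longrightarrow> c u \<noteq> c v"
  using assms unfolding colourable_def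
proof (rule exE)
  fix c :: "'a \<Rightarrow> bool"
  assume "\<forall>u\<in>W. \<forall>v\<in>W. (u, v) \<in> A \<longrightarrow> c u \<noteq> c v"
  then show thesis by (intro that[of c]) simp
qed

lemma minimal_uncolourable:
  assumes "finite S" "\<not> colourable A S"
  obtains W where "W \<subseteq> S" "\<not> colourable A W" "\<And>W'. W' \<subset> W \<Longrightarrow> colourable A W'"
proof -
  define P where "P W \<longleftrightarrow> W \<subseteq> S \<and> \<not> colourable A W" for W
  obtain W where W: "P W" "\<And>W'. P W' \<Longrightarrow> card W \<le> card W'"
    using assms ex_has_least_nat[of P S card] by (auto simp: P_def)
  show thesis
  proof
    show "W \<subseteq> S" "\<not> colourable A W" using W by (auto simp: P_def)
    show "colourable A W'" if "W' \<subset> W" for W'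
    proof (rule ccontr)
      assume "\<not> colourable A W'"
      then have "P W'" using that W(1) by (auto simp: P_def)
      then have "card W \<le> card W'" by (rule W(2))
      moreover have "finite W" using W(1) assms(1) by (auto simp: P_def intro: finite_subset)
      ultimately show False using that psubset_card_mono[of W W'] by simp
    qed
  qed
qed

text \<open>If the neighbours of \<open>v\<close> in \<open>W\<close> were all equal to \<open>b\<close>, then a colouring of \<open>W - {v}\<close> would extend to \<open>v\<close>.\<close>

lemma two_neighbours:
  assumes sym: "sym A" and irrefl: "irrefl A"
    and unc: "\<not> colourable A W" and min: "\<And>W'. W' \<subset> W \<Longrightarrow> colourable A W'" and v: "v \<in> W"
  shows "\<exists>p\<in>W. p \<noteq> b \<and> (v, p) \<in> A"
proof (rule ccontr)
  assume no: "\<not> ?thesis"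
  have "colourable A (W - {v})" using v by (intro min) auto
  then show False
  proof (rule colourableE)
    fix c :: "'a \<Rightarrow> bool"
    assume c: "\<And>u w. u \<in> W - {v} \<Longrightarrow> w \<in> W - {v} \<Longrightarrow> (u, w) \<in> A \<Longrightarrow> c u \<noteq> c w"
    have "colourable A W" unfolding colourable_def
    proof (intro exI[of _ "c(v := \<not> c b)"] ballI impI)
      fix u w assume uw: "u \<in> W" "w \<in> W" "(u, w) \<in> A"
      moreover have "(w, u) \<in> A" using uw sym by (auto dest: symD)
      moreover have "u \<noteq> w" using uw irrefl by (auto simp: irrefl_def)
      ultimately show "(c(v := \<not> c b)) u \<noteq> (c(v := \<not> c b)) w" using c[of u w] no by auto
    qed
    then show False using unc by simp
  qed
qed

text \<open>
  Among the edges of least product at \<open>a\<close>, the other end \<open>b\<close> is chosen with \<open>y b\<close> least. For \<open>y a > 0\<close> this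
  already follows from the minimality of the product; for \<open>y a = 0\<close> it is an additional choice, and it ensures
  that every further neighbour \<open>p\<close> of \<open>a\<close> has \<open>y b \<le> y p\<close>.
\<close>

lemma minimal_product_edge:
  fixes y :: "'a \<Rightarrow> real"
  assumes fin: "finite W" and sym: "sym A" and ne: "(u0, v0) \<in> A" "u0 \<in> W" "v0 \<in> W"
    and nonneg: "\<And>v. 0 \<le> y v"
  obtains a b where "(a, b) \<in> A" "a \<in> W" "b \<in> W" "y a \<le> y b"
    "\<And>u v. (u, v) \<in> A \<Longrightarrow> u \<in> W \<Longrightarrow> v \<in> W \<Longrightarrow> y a * y b \<le> y u * y v"
    "\<And>v. (a, v) \<in> A \<Longrightarrow> v \<in> W \<Longrightarrow> y b \<le> y v"
proof -
  define P where "P = {(u, v). (u, v) \<in> A \<and> u \<in> W \<and> v \<in> W}"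
  define g where "g = (\<lambda>(u, v). y u * y v)"
  have "finite P" using fin by (auto intro: finite_subset[of _ "W \<times> W"] simp: P_def)
  moreover have "P \<noteq> {}" using ne by (auto simp: P_def)
  ultimately have "arg_min_on g P \<in> P \<and> \<not> (\<exists>e\<in>P. g e < g (arg_min_on g P))"
    by (intro conjI) (use arg_min_if_finite[of P g] in auto)
  then obtain e where e: "e \<in> P" "\<And>e'. e' \<in> P \<Longrightarrow> g e \<le> g e'"
    by (intro that[of "arg_min_on g P"]) (auto simp: not_less)
  obtain a1 b1 where e_eq: "e = (a1, b1)" by fastforce
  obtain a b' where ab': "(a, b') \<in> A" "a \<in> W" "b' \<in> W" "y a \<le> y b'"
    and minP: "\<And>u v. (u, v) \<in> P \<Longrightarrow> y a * y b' \<le> y u * y v"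
  proof (cases "y a1 \<le> y b1")
    case True
    show thesis
    proof (rule that)
      show "y a1 \<le> y b1" by (rule True)
      show "y a1 * y b1 \<le> y u * y v" if "(u, v) \<in> P" for u v
        using e(2)[OF that] by (simp add: e_eq g_def)
    qed (use e(1) in \<open>auto simp: e_eq P_def\<close>)
  next
    case False
    show thesis
    proof (rule that)
      show "(b1, a1) \<in> A" using e(1) sym by (auto simp: e_eq P_def dest: symD)
      show "y b1 \<le> y a1" using False by simp
      show "y b1 * y a1 \<le> y u * y v" if "(u, v) \<in> P" for u v
        using e(2)[OF that] by (simp add: e_eq g_def mult.commute)
    qed (use e(1) in \<open>auto simp: e_eq P_def\<close>)
  qed
  define N where "N = {v \<in> W. (a, v) \<in> A}"
  have "finite N" "N \<noteq> {}" using fin ab' by (auto simp: N_def)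
  then have "arg_min_on y N \<in> N \<and> \<not> (\<exists>v\<in>N. y v < y (arg_min_on y N))"
    by (intro conjI) (use arg_min_if_finite[of N y] in auto)
  then obtain b where b: "b \<in> N" "\<And>v. v \<in> N \<Longrightarrow> y b \<le> y v"
    by (intro that[of "arg_min_on y N"]) (auto simp: not_less)
  have "y b \<le> y b'" using b(2)[of b'] ab' by (simp add: N_def)
  then have le: "y a * y b \<le> y a * y b'" using nonneg by (simp add: mult_left_mono)
  show thesis
  proof (rule that)
    show "(a, b) \<in> A" "a \<in> W" "b \<in> W" using b ab' by (auto simp: N_def)
    show "y a \<le> y b"
    proof (cases "y a = 0")
      case False
      have "y a * y b' \<le> y a * y b" using minP[of a b] b(1) ab' by (simp add: P_def N_def)
      then have "y b' \<le> y b" using False nonneg[of a] by simp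
      then show ?thesis using ab' by simp
    qed (use nonneg in simp)
    show "y a * y b \<le> y u * y v" if "(u, v) \<in> A" "u \<in> W" "v \<in> W" for u v
      using minP[of u v] le that by (simp add: P_def)
    show "y b \<le> y v" if "(a, v) \<in> A" "v \<in> W" for v using b(2)[of v] that by (simp add: N_def)
  qed
qed

definition labelled_edges :: "'a rel \<Rightarrow> (nat \<Rightarrow> 'a) \<Rightarrow> nat \<Rightarrow> nat rel" where
  "labelled_edges A h n = {(i, j). i < j \<and> j < n \<and> (h i, h j) \<in> A}"

lemma sorted_labelling_exists:
  fixes x :: "'a \<Rightarrow> real"
  assumes fin: "finite V" and sym: "sym A" and irrefl: "irrefl A"
    and S: "S \<subseteq> V" and conn: "cut_connected A S" and unc: "\<not> colourable A S"
    and leaves: "\<And>v. v \<in> V - S \<Longrightarrow> \<exists>u\<in>S. (u, v) \<in> A"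
  obtains h p q e0 f where "bij_betw h {..<card V} V"
    "sorted_labelling (card V) (card S) (labelled_edges A h (card V)) (x \<circ> h) p q e0 f"
proof -
  define n m where "n = card V" "m = card S"
  define y where "y v = \<bar>x v\<bar>" for v
  have symA: "(v, u) \<in> A" if "(u, v) \<in> A" for u v using sym that by (auto dest: symD)
  have irr: "u \<noteq> v" if "(u, v) \<in> A" for u v using irrefl that by (auto simp: irrefl_def)
  have finS: "finite S" using S fin finite_subset by blast
  obtain W where W: "W \<subseteq> S" "\<not> colourable A W" "\<And>W'. W' \<subset> W \<Longrightarrow> colourable A W'"
    using minimal_uncolourable[OF finS unc] by blast
  have finW: "finite W" using W finS finite_subset by blast
  have "\<not> (\<forall>u\<in>W. \<forall>v\<in>W. (u, v) \<in> A \<longrightarrow> (0 \<le> x u) \<noteq> (0 \<le> x v))"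
  proof
    assume "\<forall>u\<in>W. \<forall>v\<in>W. (u, v) \<in> A \<longrightarrow> (0 \<le> x u) \<noteq> (0 \<le> x v)"
    then have "colourable A W" unfolding colourable_def by (intro exI[of _ "\<lambda>v. 0 \<le> x v"])
    then show False using W(2) by simp
  qed
  then obtain u0 v0 where bad: "(u0, v0) \<in> A" "u0 \<in> W" "v0 \<in> W" "(0 \<le> x u0) = (0 \<le> x v0)"
    by metis
  obtain a b where ab: "(a, b) \<in> A" "a \<in> W" "b \<in> W" "y a \<le> y b"
    and min: "\<And>u v. (u, v) \<in> A \<Longrightarrow> u \<in> W \<Longrightarrow> v \<in> W \<Longrightarrow> y a * y b \<le> y u * y v"
    and minb: "\<And>v. (a, v) \<in> A \<Longrightarrow> v \<in> W \<Longrightarrow> y b \<le> y v"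
    using minimal_product_edge[OF finW sym bad(1-3), of y] by (auto simp: y_def)
  obtain p where p: "p \<in> W" "p \<noteq> b" "(a, p) \<in> A" using two_neighbours[OF sym irrefl W(2,3) ab(2)] by blast
  obtain q where q: "q \<in> W" "q \<noteq> a" "(b, q) \<in> A" using two_neighbours[OF sym irrefl W(2,3) ab(3)] by blast
  have pq: "p \<in> S - {a, b}" "q \<in> S - {a, b}" and abS: "a \<in> S" "b \<in> S" "a \<noteq> b"
    using p q ab irr W(1) by blast+
  obtain rs where rs: "set rs = S - {a, b}" "distinct rs" using finite_distinct_list[of "S - {a, b}"] finS by auto
  obtain ws where ws: "set ws = V - S" "distinct ws" using finite_distinct_list[of "V - S"] fin by auto
  define key where "key v = max (y v) (y b)" for v
  define ss where "ss = sort_key key rs"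
  define vs where "vs = a # b # ss @ ws"
  define h where "h i = vs ! i" for i
  have dist: "distinct vs" and setV: "set vs = V"
    using rs ws S abS by (auto simp: vs_def ss_def)
  have len: "length vs = n" using distinct_card[OF dist] setV by (simp add: n_m_def)
  have bij: "bij_betw h {..<n} V"
    unfolding h_def using bij_betw_nth[OF dist] len setV by simp
  have inj: "h i = h j \<longleftrightarrow> i = j" if "i < n" "j < n" for i j
    using that dist len by (simp add: h_def nth_eq_iff_index_eq)
  have m_len: "m = Suc (Suc (length ss))"
  proof -
    have "distinct (a # b # ss)" "set (a # b # ss) = S" using rs abS by (auto simp: ss_def)
    then show ?thesis using distinct_card[of "a # b # ss"] by (simp add: n_m_def)
  qed
  have mn: "m \<le> n" using S fin by (simp add: n_m_def card_mono)
  have h0: "h 0 = a" "h 1 = b" "h (Suc 0) = b" by (simp_all add: h_def vs_def)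
  have h_mid: "h (Suc (Suc i)) = ss ! i" if "i < length ss" for i using that by (simp add: h_def vs_def nth_append)
  have idx: "\<exists>i. 2 \<le> i \<and> i < m \<and> h i = v" if "v \<in> S - {a, b}" for v
  proof -
    have "v \<in> set ss" using that rs by (simp add: ss_def)
    then obtain i where "i < length ss" "ss ! i = v" by (auto simp: in_set_conv_nth)
    then show ?thesis using h_mid[of i] m_len by (intro exI[of _ "Suc (Suc i)"]) auto
  qed
  have idxS: "\<exists>i<m. h i = v" if "v \<in> S" for v
    using that idx[of v] h0 m_len by (cases "v \<in> {a, b}") auto
  have hS: "h i \<in> S" if "i < m" for i
  proof -
    consider "i = 0" | "i = 1" | j where "i = Suc (Suc j)" by (metis One_nat_def not0_implies_Suc)
    then show ?thesis
    proof cases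
      case 3
      then have "h i = ss ! j" "j < length ss" using h_mid[of j] that m_len by auto
      then have "h i \<in> set ss" by auto
      then show ?thesis using rs by (simp add: ss_def)
    qed (use abS h0 in auto)
  qed
  have hL: "h i \<in> V - S" if "m \<le> i" "i < n" for i
  proof -
    have "h i \<in> V" using bij that by (auto simp: bij_betw_def)
    moreover have "h i \<notin> S" using idxS[of "h i"] inj that mn by (metis less_le_trans not_le)
    ultimately show ?thesis by simp
  qed
  define E where "E = labelled_edges A h n"
  have E: "(i, j) \<in> E \<longleftrightarrow> i < j \<and> j < n \<and> (h i, h j) \<in> A" for i j by (simp add: E_def labelled_edges_def)
  obtain p' where p': "2 \<le> p'" "p' < m" "h p' = p" using idx pq by blast
  obtain q' where q': "2 \<le> q'" "q' < m" "h q' = q" using idx pq by blast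
  obtain i0 j0 where ij: "i0 < m" "h i0 = u0" "j0 < m" "h j0 = v0" using idxS bad W(1) by (meson subsetD)
  have ij_ne: "i0 \<noteq> j0" using ij irr[OF bad(1)] by auto
  define f where "f v = (SOME u. u < m \<and> (h u, h v) \<in> A)" for v
  have labelling: "sorted_labelling n m E (x \<circ> h) p' q' (min i0 j0, max i0 j0) f"
  proof
    show "3 \<le> m" using p' by simp
    show "m \<le> n" by (rule mn)
    show "E \<subseteq> {(i, j). i < j \<and> j < n}" using E by auto
    show "(0, 1) \<in> E" using h0 ab p' mn by (simp add: E)
    show "(0, p') \<in> E" "(1, q') \<in> E" using h0 p q p' q' mn by (auto simp: E)
    show "2 \<le> p'" "p' < m" "2 \<le> q'" "q' < m" using p' q' by auto
    show "(min i0 j0, max i0 j0) \<in> E"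
      using ij ij_ne bad(1) symA[OF bad(1)] mn by (auto simp: E min_def max_def)
    show "snd (min i0 j0, max i0 j0) < m" using ij by simp
    show "\<bar>(x \<circ> h) 0\<bar> * \<bar>(x \<circ> h) 1\<bar> \<le> (x \<circ> h) (fst (min i0 j0, max i0 j0)) * (x \<circ> h) (snd (min i0 j0, max i0 j0))"
    proof -
      have "0 \<le> x u0 * x v0" using bad(4) by (cases "0 \<le> x u0") (auto intro: mult_nonneg_nonneg mult_nonpos_nonpos)
      then have "y u0 * y v0 = x u0 * x v0" by (simp add: y_def abs_mult[symmetric])
      then have "y a * y b \<le> x u0 * x v0" using min[OF bad(1-3)] by simp
      then show ?thesis using h0 ij by (auto simp: y_def min_def max_def mult.commute)
    qed
    show "\<bar>(x \<circ> h) 0\<bar> \<le> \<bar>(x \<circ> h) 1\<bar>" using ab(4) h0 by (simp add: y_def)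
    show "\<bar>(x \<circ> h) 1\<bar> \<le> \<bar>(x \<circ> h) p'\<bar>" using minb[OF p(3,1)] h0 p' by (simp add: y_def)
    show "max \<bar>(x \<circ> h) i\<bar> \<bar>(x \<circ> h) 1\<bar> \<le> max \<bar>(x \<circ> h) (Suc i)\<bar> \<bar>(x \<circ> h) 1\<bar>" if "2 \<le> i" "Suc i < m" for i
    proof -
      define j where "j = i - 2"
      have j: "i = Suc (Suc j)" using that(1) by (simp add: j_def)
      have "sorted (map key ss)" by (simp add: ss_def)
      then have "key (ss ! j) \<le> key (ss ! Suc j)"
        using that j m_len sorted_nth_mono[of "map key ss" j "Suc j"] by simp
      then show ?thesis using h_mid[of j] h_mid[of "Suc j"] that j m_len h0 by (simp add: key_def y_def)
    qed
    show "\<exists>u v. (u, v) \<in> E \<and> u \<le> i \<and> i < v \<and> v < m" if "2 \<le> i" "Suc i < m" for i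
    proof -
      have "h (Suc i) \<in> S - h ` {..i}" using hS[of "Suc i"] inj that mn by auto
      moreover have "h ` {..i} \<subseteq> S" using hS that by auto
      ultimately have "\<exists>u\<in>h ` {..i}. \<exists>v\<in>S - h ` {..i}. (u, v) \<in> A"
        by (intro cut_connectedD[OF conn]) auto
      then obtain u v where uv: "u \<in> h ` {..i}" "v \<in> S - h ` {..i}" "(u, v) \<in> A" by (elim bexE)
      obtain u' where u': "u' \<le> i" "u = h u'" using uv(1) by auto
      obtain v' where v': "v' < m" "v = h v'" using idxS[of v] uv(2) by auto
      have "i < v'" using uv(2) v' by (auto simp: not_le[symmetric])
      then show ?thesis using uv(3) u' v' mn by (intro exI[of _ u'] exI[of _ v']) (auto simp: E)
    qed
    show "f v < m \<and> (f v, v) \<in> E" if "m \<le> v" "v < n" for v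
    proof -
      have "\<exists>u\<in>S. (u, h v) \<in> A" using that by (intro leaves hL)
      then have "\<exists>u. u < m \<and> (h u, h v) \<in> A" using idxS by blast
      then have "f v < m \<and> (h (f v), h v) \<in> A" unfolding f_def by (rule someI_ex)
      then show ?thesis using that by (simp add: E)
    qed
  qed
  show thesis
  proof (rule that)
    show "bij_betw h {..<card V} V" using bij by (simp add: n_m_def)
    show "sorted_labelling (card V) (card S) (labelled_edges A h (card V)) (x \<circ> h) p' q' (min i0 j0, max i0 j0) f"
      using labelling unfolding E_def n_m_def .
  qed
qed

lemma energy_labelled_edges:
  assumes A: "A \<subseteq> V \<times> V" and sym: "sym A" and irrefl: "irrefl A" and bij: "bij_betw h {..<n} V"
  shows "energy A x = 2 * energy (labelled_edges A h n) (x \<circ> h)"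
proof -
  define E where "E = labelled_edges A h n"
  define B where "B = {(i, j). i < n \<and> j < n \<and> (h i, h j) \<in> A}"
  have finB: "finite B" by (rule finite_subset[of _ "{..<n} \<times> {..<n}"]) (auto simp: B_def)
  have irr: "i \<noteq> j" if "(h i, h j) \<in> A" for i j using that irrefl by (auto simp: irrefl_def)
  have symA: "(v, u) \<in> A" if "(u, v) \<in> A" for u v using sym that by (auto dest: symD)
  have B: "B = E \<union> E\<inverse>" "E \<inter> E\<inverse> = {}"
  proof -
    have "(i, j) \<in> B \<longleftrightarrow> (i, j) \<in> E \<or> (j, i) \<in> E" for i j
      using irr[of i j] symA[of "h i" "h j"] symA[of "h j" "h i"]
      by (cases i j rule: linorder_cases) (auto simp: B_def E_def labelled_edges_def)
    then show "B = E \<union> E\<inverse>" by auto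
  qed (auto simp: E_def labelled_edges_def)
  have finE: "finite E" "finite (E\<inverse>)" using finB B by auto
  have "A = (\<lambda>(i, j). (h i, h j)) ` B"
  proof (intro equalityI subsetI)
    fix e assume e: "e \<in> A"
    obtain u v where uv: "e = (u, v)" by fastforce
    have "u \<in> h ` {..<n}" "v \<in> h ` {..<n}" using e uv A bij by (auto simp: bij_betw_def)
    then show "e \<in> (\<lambda>(i, j). (h i, h j)) ` B" using e uv by (auto simp: B_def)
  qed (auto simp: B_def)
  moreover have "inj_on (\<lambda>(i, j). (h i, h j)) B"
    using bij by (auto simp: inj_on_def B_def bij_betw_def)
  ultimately have "energy A x = (\<Sum>e\<in>B. ((\<lambda>(u, v). (x u + x v)\<^sup>2) \<circ> (\<lambda>(i, j). (h i, h j))) e)"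
    unfolding energy_def by (metis sum.reindex)
  also have "\<dots> = energy B (x \<circ> h)" by (simp add: energy_def case_prod_unfold)
  also have "\<dots> = energy E (x \<circ> h) + energy (E\<inverse>) (x \<circ> h)"
    unfolding B(1) energy_def using finE B(2) by (rule sum.union_disjoint)
  also have "energy (E\<inverse>) (x \<circ> h) = energy E (x \<circ> h)"
  proof -
    have swap: "prod.swap ` E = E\<inverse>" by auto
    have "energy (E\<inverse>) (x \<circ> h) = sum ((\<lambda>(u, v). ((x \<circ> h) u + (x \<circ> h) v)\<^sup>2) \<circ> prod.swap) E"
      unfolding energy_def swap[symmetric] by (rule sum.reindex) (auto simp: inj_on_def)
    then show ?thesis by (simp add: energy_def case_prod_unfold add.commute)
  qed
  finally show ?thesis unfolding E_def by linarith
qed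

section \<open>The least eigenvalue as a minimal Rayleigh quotient\<close>

text \<open>The signless Laplacian, acting on functions on the vertices.\<close>

definition signless_op :: "'a rel \<Rightarrow> ('a \<Rightarrow> real) \<Rightarrow> 'a \<Rightarrow> real" where
  "signless_op A x u = (\<Sum>v\<in>A `` {u}. x u + x v)"

lemma energy_polar:
  assumes fin: "finite V" and A: "A \<subseteq> V \<times> V" and sym: "sym A"
  shows "(\<Sum>(u, v)\<in>A. (x u + x v) * (d u + d v)) = 2 * (\<Sum>u\<in>V. d u * signless_op A x u)"
proof -
  have finA: "finite A" using fin A finite_subset by blast
  have swap: "prod.swap ` A = A"
  proof (intro equalityI subsetI)
    fix e assume "e \<in> A"
    then have "prod.swap e \<in> A" using sym by (cases e) (auto dest: symD)
    then show "e \<in> prod.swap ` A" by (intro image_eqI[of _ _ "prod.swap e"]) auto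
  qed (use sym in \<open>auto dest: symD\<close>)
  have "(\<Sum>(u, v)\<in>prod.swap ` A. (x u + x v) * d v) = (\<Sum>(u, v)\<in>A. (x u + x v) * d u)"
    by (subst sum.reindex) (auto simp: case_prod_unfold add.commute inj_on_def)
  then have "(\<Sum>(u, v)\<in>A. (x u + x v) * (d u + d v)) = 2 * (\<Sum>(u, v)\<in>A. (x u + x v) * d u)"
    unfolding swap by (simp add: distrib_left sum.distrib case_prod_unfold)
  also have "(\<Sum>(u, v)\<in>A. (x u + x v) * d u) = (\<Sum>u\<in>V. \<Sum>v\<in>A `` {u}. (x u + x v) * d u)"
  proof -
    have "Sigma V (\<lambda>u. A `` {u}) = A" using A by auto
    moreover have "\<forall>u\<in>V. finite (A `` {u})" using finA by (auto intro: finite_Image)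
    ultimately show ?thesis using sum.Sigma[OF fin, of "\<lambda>u. A `` {u}" "\<lambda>u v. (x u + x v) * d u"] by simp
  qed
  also have "\<dots> = (\<Sum>u\<in>V. d u * signless_op A x u)"
    unfolding signless_op_def sum_distrib_left by (simp add: mult.commute)
  finally show ?thesis .
qed

lemma energy_eigenfunction:
  assumes fin: "finite V" and A: "A \<subseteq> V \<times> V" and sym: "sym A"
    and eig: "\<And>u. u \<in> V \<Longrightarrow> signless_op A x u = k * x u"
  shows "energy A x / 2 = k * (\<Sum>v\<in>V. (x v)\<^sup>2)"
proof -
  have "energy A x = (\<Sum>(u, v)\<in>A. (x u + x v) * (x u + x v))" by (simp add: energy_def power2_eq_square)
  also have "\<dots> = 2 * (\<Sum>u\<in>V. x u * (k * x u))" unfolding energy_polar[OF fin A sym] using eig by simp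
  finally show ?thesis by (simp add: sum_distrib_left power2_eq_square algebra_simps)
qed

lemma compact_unit_sphere:
  assumes "finite V"
  shows "compact {x :: 'a \<Rightarrow> real. (\<Sum>v\<in>V. (x v)\<^sup>2) = 1 \<and> (\<forall>v. v \<notin> V \<longrightarrow> x v = 0)}" (is "compact ?S")
proof -
  define K where "K v = (if v \<in> V then {-1..1} else {0 :: real})" for v :: 'a
  have "compactin (product_topology (\<lambda>_. euclidean) UNIV) (PiE UNIV K)"
    by (simp add: compactin_PiE K_def)
  then have "compactin euclidean (PiE UNIV K)" by (simp only: euclidean_product_topology)
  then have comp: "compact (PiE UNIV K)" by (simp only: compactin_euclidean_iff)
  have cont: "continuous_on UNIV (\<lambda>x :: 'a \<Rightarrow> real. \<Sum>v\<in>V. (x v)\<^sup>2)"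
    by (intro continuous_on_sum continuous_on_power continuous_on_product_coordinates)
  have "?S = PiE UNIV K \<inter> (\<lambda>x. \<Sum>v\<in>V. (x v)\<^sup>2) -` {1}"
  proof (intro equalityI subsetI)
    fix x assume x: "x \<in> ?S"
    have "x v \<in> K v" for v
    proof (cases "v \<in> V")
      case True
      then have "(x v)\<^sup>2 \<le> (\<Sum>v\<in>V. (x v)\<^sup>2)" using assms by (intro member_le_sum) auto
      then have "(x v)\<^sup>2 \<le> 1" using x by simp
      then have "\<bar>x v\<bar> \<le> 1" by (simp add: abs_square_le_1)
      then show ?thesis using True by (simp add: K_def abs_le_iff)
    qed (use x in \<open>auto simp: K_def\<close>)
    then show "x \<in> PiE UNIV K \<inter> (\<lambda>x. \<Sum>v\<in>V. (x v)\<^sup>2) -` {1}" using x by auto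
  next
    fix x assume x: "x \<in> PiE UNIV K \<inter> (\<lambda>x. \<Sum>v\<in>V. (x v)\<^sup>2) -` {1}"
    have "x v = 0" if "v \<notin> V" for v
    proof -
      have "x v \<in> K v" using x by auto
      then show ?thesis using that by (simp add: K_def)
    qed
    then show "x \<in> ?S" using x by simp
  qed
  moreover have "closed ((\<lambda>x :: 'a \<Rightarrow> real. \<Sum>v\<in>V. (x v)\<^sup>2) -` {1})"
    using cont by (intro closed_vimage) auto
  ultimately show ?thesis using comp by (simp add: compact_Int_closed)
qed

lemma energy_scale: "energy A (\<lambda>v. c * x v) = c\<^sup>2 * energy A x"
proof -
  have "(c * a + c * b)\<^sup>2 = c\<^sup>2 * (a + b)\<^sup>2" for a b :: real by (simp add: power2_eq_square algebra_simps)
  then show ?thesis by (simp add: energy_def sum_distrib_left case_prod_unfold)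
qed

lemma energy_cong: "A \<subseteq> V \<times> V \<Longrightarrow> (\<And>v. v \<in> V \<Longrightarrow> x v = y v) \<Longrightarrow> energy A x = energy A y"
  unfolding energy_def by (intro sum.cong) auto

text \<open>A minimiser of the form on the unit sphere exists by compactness, and its first variation in the direction
  of each vertex gives the eigenvalue equation.\<close>

lemma minimal_eigenfunction:
  fixes A :: "'a rel"
  assumes fin: "finite V" and ne: "V \<noteq> {}" and A: "A \<subseteq> V \<times> V" and sym: "sym A"
  obtains x \<mu> where "\<exists>v\<in>V. x v \<noteq> 0" "\<And>u. u \<in> V \<Longrightarrow> signless_op A x u = \<mu> * x u"
    "\<And>w. \<mu> * (\<Sum>v\<in>V. (w v)\<^sup>2) \<le> energy A w / 2"
proof -
  define S where "S = {x :: 'a \<Rightarrow> real. (\<Sum>v\<in>V. (x v)\<^sup>2) = 1 \<and> (\<forall>v. v \<notin> V \<longrightarrow> x v = 0)}"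
  have comp: "compact S" using compact_unit_sphere[OF fin] by (simp add: S_def)
  obtain v0 where v0: "v0 \<in> V" using ne by auto
  have "(\<Sum>v\<in>V. (if v = v0 then 1 else 0 :: real)\<^sup>2) = (\<Sum>v\<in>V. if v = v0 then 1 else 0)"
    by (intro sum.cong) auto
  then have "(\<lambda>v. if v = v0 then 1 else 0) \<in> S" using v0 fin by (auto simp: S_def)
  then have Sne: "S \<noteq> {}" by auto
  have coord: "continuous_on S (\<lambda>x. x v)" for v
    by (rule continuous_on_subset[OF continuous_on_product_coordinates]) simp
  have cont: "continuous_on S (energy A)"
    unfolding energy_def case_prod_unfold
    by (intro continuous_on_sum continuous_on_power continuous_on_add coord)
  obtain x where x: "x \<in> S" "\<And>w. w \<in> S \<Longrightarrow> energy A x \<le> energy A w"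
    using continuous_attains_inf[OF comp Sne cont] by blast
  define \<mu> where "\<mu> = energy A x / 2"
  have norm_x: "(\<Sum>v\<in>V. (x v)\<^sup>2) = 1" using x by (simp add: S_def)
  have min: "\<mu> * (\<Sum>v\<in>V. (w v)\<^sup>2) \<le> energy A w / 2" for w
  proof (cases "(\<Sum>v\<in>V. (w v)\<^sup>2) = 0")
    case True
    then show ?thesis by (auto simp: energy_def intro: sum_nonneg)
  next
    case False
    define N where "N = (\<Sum>v\<in>V. (w v)\<^sup>2)"
    have N: "0 < N" using False unfolding N_def by (metis less_eq_real_def sum_nonneg zero_le_power2)
    define c where "c = 1 / sqrt N"
    have c2: "c\<^sup>2 = 1 / N" using N by (simp add: c_def power_divide)
    define w' where "w' v = (if v \<in> V then c * w v else 0)" for v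
    have "(\<Sum>v\<in>V. (w' v)\<^sup>2) = c\<^sup>2 * N" by (simp add: w'_def N_def power_mult_distrib sum_distrib_left)
    then have "w' \<in> S" using N c2 by (simp add: S_def w'_def)
    then have "energy A x \<le> energy A w'" by (rule x(2))
    also have "\<dots> = energy A (\<lambda>v. c * w v)" by (rule energy_cong[OF A]) (simp add: w'_def)
    also have "\<dots> = energy A w / N" by (simp add: energy_scale c2)
    finally show ?thesis using N by (simp add: \<mu>_def N_def[symmetric] field_simps)
  qed
  show thesis
  proof (rule that)
    show "\<exists>v\<in>V. x v \<noteq> 0"
    proof (rule ccontr)
      assume "\<not> ?thesis"
      then have "(\<Sum>v\<in>V. (x v)\<^sup>2) = 0" by (intro sum.neutral) auto
      then show False using norm_x by simp
    qed
    show "signless_op A x u = \<mu> * x u" if u: "u \<in> V" for u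
    proof -
      define d where "d v = (if v = u then 1 else 0 :: real)" for v
      define b where "b = signless_op A x u - \<mu> * x u"
      have sums: "(\<Sum>v\<in>V. d v * g v) = g u" for g
        using u fin by (simp add: d_def if_distrib[of "\<lambda>c. c * _"] cong: if_cong)
      have "0 \<le> 2 * t * b + t\<^sup>2 * (energy A d / 2 - \<mu> * (\<Sum>v\<in>V. (d v)\<^sup>2))" for t
      proof -
        have "((p + t * q) + (p' + t * q'))\<^sup>2 = (p + p')\<^sup>2 + 2 * t * ((p + p') * (q + q')) + t\<^sup>2 * (q + q')\<^sup>2"
          for p q p' q' :: real by (simp add: power2_eq_square algebra_simps)
        then have "energy A (\<lambda>v. x v + t * d v) =
            energy A x + 2 * t * (\<Sum>(u, v)\<in>A. (x u + x v) * (d u + d v)) + t\<^sup>2 * energy A d"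
          by (simp add: energy_def case_prod_unfold sum.distrib sum_distrib_left)
        also have "\<dots> = energy A x + 2 * t * (2 * signless_op A x u) + t\<^sup>2 * energy A d"
          unfolding energy_polar[OF fin A sym] sums ..
        finally have e: "energy A (\<lambda>v. x v + t * d v) = \<dots>" .
        have "(x v + t * d v)\<^sup>2 = (x v)\<^sup>2 + 2 * t * (d v * x v) + t\<^sup>2 * (d v)\<^sup>2" for v
          by (simp add: power2_eq_square algebra_simps)
        then have "(\<Sum>v\<in>V. (x v + t * d v)\<^sup>2) = 1 + 2 * t * (\<Sum>v\<in>V. d v * x v) + t\<^sup>2 * (\<Sum>v\<in>V. (d v)\<^sup>2)"
          by (simp add: sum.distrib sum_distrib_left norm_x)
        then show ?thesis using min[of "\<lambda>v. x v + t * d v"] unfolding e sums b_def \<mu>_def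
          by (simp add: algebra_simps)
      qed
      then have "b = 0" by (rule linear_coefficient_zero)
      then show ?thesis by (simp add: b_def)
    qed
    show "\<mu> * (\<Sum>v\<in>V. (w v)\<^sup>2) \<le> energy A w / 2" for w by (rule min)
  qed
qed

lemma signless_laplacian_mult:
  assumes G: "pair_graph G" and n: "n = card (pverts G)" and i: "i < n"
  shows "(signless_laplacian G *\<^sub>v vec n (\<lambda>i. x (vertex_list G ! i))) $ i
    = signless_op (parcs G) x (vertex_list G ! i)"
proof -
  interpret pair_graph G by (rule G)
  define vs where "vs = vertex_list G"
  have vs: "distinct vs" "set vs = pverts G"
    using someI_ex[OF finite_distinct_list[OF pair_finite_verts]]
    by (auto simp: vs_def vertex_list_def conj_commute)
  have len: "length vs = n" using distinct_card[OF vs(1)] vs(2) n by simp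
  define a where "a j = (if (vs ! i, vs ! j) \<in> parcs G then 1 else 0 :: real)" for j
  define N where "N = parcs G `` {vs ! i}"
  have finN: "finite N" unfolding N_def using pair_finite_arcs by (rule finite_Image)
  have sum_N: "(\<Sum>v\<in>N. g v) = (\<Sum>j<n. a j * g (vs ! j))" for g :: "_ \<Rightarrow> real"
  proof -
    have "bij_betw (\<lambda>j. vs ! j) {j. j < n \<and> (vs ! i, vs ! j) \<in> parcs G} N"
      unfolding bij_betw_def
    proof
      show "inj_on ((!) vs) {j. j < n \<and> (vs ! i, vs ! j) \<in> parcs G}"
        using vs(1) len by (auto simp: inj_on_def nth_eq_iff_index_eq)
      show "(!) vs ` {j. j < n \<and> (vs ! i, vs ! j) \<in> parcs G} = N"
      proof (intro equalityI subsetI)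
        fix v assume v: "v \<in> N"
        then have "v \<in> set vs" using vs(2) by (auto simp: N_def dest: in_arcsD2)
        then obtain j where "j < n" "v = vs ! j" using len by (auto simp: in_set_conv_nth)
        then show "v \<in> (!) vs ` {j. j < n \<and> (vs ! i, vs ! j) \<in> parcs G}" using v by (auto simp: N_def)
      qed (auto simp: N_def)
    qed
    then have "(\<Sum>v\<in>N. g v) = (\<Sum>j\<in>{j. j < n \<and> (vs ! i, vs ! j) \<in> parcs G}. g (vs ! j))"
      by (rule sum.reindex_bij_betw[symmetric])
    also have "\<dots> = (\<Sum>j<n. a j * g (vs ! j))"
      by (rule sum.mono_neutral_cong_left) (auto simp: a_def)
    finally show ?thesis .
  qed
  have deg: "real (out_degree (with_proj G) (vs ! i)) = (\<Sum>v\<in>N. 1)"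
  proof -
    have "out_arcs (with_proj G) (vs ! i) = Pair (vs ! i) ` N" by (auto simp: out_arcs_def N_def)
    then have "card (out_arcs (with_proj G) (vs ! i)) = card N" by (simp add: card_image inj_on_def)
    then show ?thesis by (simp add: out_degree_def)
  qed
  have Q: "signless_laplacian G \<in> carrier_mat n n"
    by (simp add: signless_laplacian_def degree_matrix_def adjacency_matrix_def Let_def n)
  have entry: "signless_laplacian G $$ (i, j) = (if i = j then real (out_degree (with_proj G) (vs ! i)) else 0) + a j"
    if "j < n" for j
    using that i by (simp add: signless_laplacian_def degree_matrix_def adjacency_matrix_def Let_def n a_def vs_def)
  have "(signless_laplacian G *\<^sub>v vec n (\<lambda>i. x (vs ! i))) $ i =
      (\<Sum>j = 0..<n. signless_laplacian G $$ (i, j) * x (vs ! j))"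
    using Q i by (simp add: scalar_prod_def)
  also have "\<dots> = (\<Sum>j<n. (if i = j then real (out_degree (with_proj G) (vs ! i)) else 0) * x (vs ! j) + a j * x (vs ! j))"
    by (intro sum.cong) (auto simp: entry distrib_right)
  also have "\<dots> = real (out_degree (with_proj G) (vs ! i)) * x (vs ! i) + (\<Sum>v\<in>N. x v)"
    using i by (simp add: sum.distrib sum_N if_distrib[of "\<lambda>c. c * _"] cong: if_cong)
  also have "\<dots> = signless_op (parcs G) x (vs ! i)"
    unfolding deg signless_op_def N_def[symmetric] by (simp add: sum.distrib)
  finally show ?thesis by (simp add: vs_def)
qed

text \<open>This removes the listing of the vertices, which only serves to index the matrix.\<close>

lemma eigenvalue_signless_laplacian:
  assumes G: "pair_graph G"
  shows "eigenvalue (signless_laplacian G) k \<longleftrightarrow>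
    (\<exists>x. (\<exists>v\<in>pverts G. x v \<noteq> 0) \<and> (\<forall>u\<in>pverts G. signless_op (parcs G) x u = k * x u))"
proof -
  interpret pair_graph G by (rule G)
  define n where "n = card (pverts G)"
  define vs where "vs = vertex_list G"
  have vs: "distinct vs" "set vs = pverts G"
    using someI_ex[OF finite_distinct_list[OF pair_finite_verts]]
    by (auto simp: vs_def vertex_list_def conj_commute)
  have len: "length vs = n" using distinct_card[OF vs(1)] vs(2) n_def by simp
  have all: "(\<forall>u\<in>pverts G. P u) \<longleftrightarrow> (\<forall>i<n. P (vs ! i))" for P
    unfolding vs(2)[symmetric] len[symmetric] by (rule all_set_conv_all_nth)
  have Q: "signless_laplacian G \<in> carrier_mat n n"
    by (simp add: signless_laplacian_def degree_matrix_def adjacency_matrix_def Let_def n_def)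
  have eig: "eigenvector (signless_laplacian G) (vec n (\<lambda>i. x (vs ! i))) k \<longleftrightarrow>
      (\<exists>v\<in>pverts G. x v \<noteq> 0) \<and> (\<forall>u\<in>pverts G. signless_op (parcs G) x u = k * x u)" for x
  proof -
    have "vec n (\<lambda>i. x (vs ! i)) = 0\<^sub>v n \<longleftrightarrow> (\<forall>u\<in>pverts G. x u = 0)"
      unfolding all by (auto simp: vec_eq_iff)
    moreover have "signless_laplacian G *\<^sub>v vec n (\<lambda>i. x (vs ! i)) = k \<cdot>\<^sub>v vec n (\<lambda>i. x (vs ! i)) \<longleftrightarrow>
        (\<forall>u\<in>pverts G. signless_op (parcs G) x u = k * x u)"
      unfolding all using Q signless_laplacian_mult[OF G n_def, of _ x]
      by (auto simp: vec_eq_iff vs_def)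
    ultimately show ?thesis using Q by (auto simp: eigenvector_def)
  qed
  show ?thesis
  proof
    assume "eigenvalue (signless_laplacian G) k"
    then obtain w where w: "eigenvector (signless_laplacian G) w k" by (auto simp: eigenvalue_def)
    define x where "x v = w $ (the_inv_into {..<n} ((!) vs) v)" for v
    have "inj_on ((!) vs) {..<n}" using vs(1) len by (auto simp: inj_on_def nth_eq_iff_index_eq)
    then have "x (vs ! i) = w $ i" if "i < n" for i using that by (simp add: x_def the_inv_into_f_f)
    then have "vec n (\<lambda>i. x (vs ! i)) = w" using w Q by (auto simp: eigenvector_def vec_eq_iff)
    then show "\<exists>x. (\<exists>v\<in>pverts G. x v \<noteq> 0) \<and> (\<forall>u\<in>pverts G. signless_op (parcs G) x u = k * x u)"
      using eig[of x] w by auto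
  next
    assume "\<exists>x. (\<exists>v\<in>pverts G. x v \<noteq> 0) \<and> (\<forall>u\<in>pverts G. signless_op (parcs G) x u = k * x u)"
    then show "eigenvalue (signless_laplacian G) k" using eig by (auto simp: eigenvalue_def)
  qed
qed

lemma pair_graph_arcs:
  assumes "pair_graph G"
  shows "finite (pverts G)" "parcs G \<subseteq> pverts G \<times> pverts G" "sym (parcs G)" "irrefl (parcs G)"
proof -
  interpret pair_graph G by (rule assms)
  show "finite (pverts G)" by (rule pair_finite_verts)
  show "parcs G \<subseteq> pverts G \<times> pverts G" by (auto dest: in_arcsD1 in_arcsD2)
  show "sym (parcs G)" using pair_sym_arcs by (simp add: symmetric_def)
  show "irrefl (parcs G)" using pair_no_loops by (fastforce simp: irrefl_def)
qed

lemma least_Q_eigenvalue_rayleigh: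
  assumes G: "pair_graph G" and ne: "pverts G \<noteq> {}"
  shows "least_Q_eigenvalue G * (\<Sum>v\<in>pverts G. (w v)\<^sup>2) \<le> energy (parcs G) w / 2"
    and "\<exists>x. (\<exists>v\<in>pverts G. x v \<noteq> 0) \<and> energy (parcs G) x / 2 = least_Q_eigenvalue G * (\<Sum>v\<in>pverts G. (x v)\<^sup>2)"
proof -
  note arcs = pair_graph_arcs[OF G]
  obtain x \<mu> where x: "\<exists>v\<in>pverts G. x v \<noteq> 0"
      "\<And>u. u \<in> pverts G \<Longrightarrow> signless_op (parcs G) x u = \<mu> * x u"
    and min: "\<And>w. \<mu> * (\<Sum>v\<in>pverts G. (w v)\<^sup>2) \<le> energy (parcs G) w / 2"
    using minimal_eigenfunction[OF arcs(1) ne arcs(2,3)] by blast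
  have "\<mu> \<le> k" if "k \<in> spectrum (signless_laplacian G)" for k
  proof -
    have "eigenvalue (signless_laplacian G) k" using that by (simp add: spectrum_def)
    then obtain y where y: "\<exists>v\<in>pverts G. y v \<noteq> 0" "\<And>u. u \<in> pverts G \<Longrightarrow> signless_op (parcs G) y u = k * y u"
      unfolding eigenvalue_signless_laplacian[OF G] by blast
    have "\<mu> * (\<Sum>v\<in>pverts G. (y v)\<^sup>2) \<le> k * (\<Sum>v\<in>pverts G. (y v)\<^sup>2)"
      using min[of y] energy_eigenfunction[OF arcs(1-3) y(2)] by simp
    moreover have "0 < (\<Sum>v\<in>pverts G. (y v)\<^sup>2)"
    proof -
      obtain v where "v \<in> pverts G" "y v \<noteq> 0" using y(1) by blast
      then show ?thesis using arcs(1) by (intro sum_pos2[of _ v]) auto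
    qed
    ultimately show ?thesis by simp
  qed
  moreover have "\<mu> \<in> spectrum (signless_laplacian G)"
    using x eigenvalue_signless_laplacian[OF G] by (auto simp: spectrum_def)
  moreover have "finite (spectrum (signless_laplacian G))"
    by (rule card_finite_spectrum(1)[of _ "card (pverts G)"])
      (simp add: signless_laplacian_def degree_matrix_def adjacency_matrix_def Let_def)
  ultimately have eq: "least_Q_eigenvalue G = \<mu>" unfolding least_Q_eigenvalue_def by (intro Min_eqI)
  show "least_Q_eigenvalue G * (\<Sum>v\<in>pverts G. (w v)\<^sup>2) \<le> energy (parcs G) w / 2" using min eq by simp
  show "\<exists>x. (\<exists>v\<in>pverts G. x v \<noteq> 0) \<and> energy (parcs G) x / 2 = least_Q_eigenvalue G * (\<Sum>v\<in>pverts G. (x v)\<^sup>2)"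
    using x energy_eigenfunction[OF arcs(1-3) x(2)] eq by blast
qed

section \<open>Connected nonbipartite sets containing a dominating set\<close>

lemma cut_connectedI:
  assumes "\<And>T. T \<subset> S \<Longrightarrow> T \<noteq> {} \<Longrightarrow> \<exists>u\<in>T. \<exists>v\<in>S - T. (u, v) \<in> A"
  shows "cut_connected A S"
  unfolding cut_connected_def by (intro allI impI assms)

lemma cut_connected_insert:
  assumes conn: "cut_connected A S" and sym: "sym A" and v: "v \<in> S \<or> (\<exists>u\<in>S. (u, v) \<in> A)"
  shows "cut_connected A (insert v S)"
proof (cases "v \<in> S")
  case True
  then show ?thesis using conn by (simp add: insert_absorb)
next
  case False
  then obtain u where u: "u \<in> S" "(u, v) \<in> A" using v by blast
  then have vu: "(v, u) \<in> A" using sym by (blast dest: symD)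
  show ?thesis
  proof (rule cut_connectedI)
    fix T assume T: "T \<subset> insert v S" "T \<noteq> {}"
    show "\<exists>a\<in>T. \<exists>b\<in>insert v S - T. (a, b) \<in> A"
    proof (cases "T \<inter> S = {}")
      case True
      then have "T = {v}" using T by blast
      then show ?thesis using vu u False by blast
    next
      case ne: False
      show ?thesis
      proof (cases "S \<subseteq> T")
        case True
        then have "v \<notin> T" using T by blast
        then show ?thesis using True u by blast
      next
        case False
        then have "T \<inter> S \<subset> S" by blast
        then have "\<exists>a\<in>T \<inter> S. \<exists>b\<in>S - T \<inter> S. (a, b) \<in> A" using ne by (rule cut_connectedD[OF conn])
        then show ?thesis by blast
      qed
    qed
  qed
qed

lemma cut_connected_singleton: "cut_connected A {v}"
  by (rule cut_connectedI) blast

lemma uncolourable_mono: "S \<subseteq> S' \<Longrightarrow> \<not> colourable A S \<Longrightarrow> \<not> colourable A S'"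
proof (erule contrapos_nn)
  assume sub: "S \<subseteq> S'" and "colourable A S'"
  from this(2) show "colourable A S"
  proof (rule colourableE)
    fix c :: "'a \<Rightarrow> bool"
    assume c: "\<And>u v. u \<in> S' \<Longrightarrow> v \<in> S' \<Longrightarrow> (u, v) \<in> A \<Longrightarrow> c u \<noteq> c v"
    show "colourable A S"
      unfolding colourable_def by (intro exI[of _ c] ballI impI c) (use sub in auto)
  qed
qed

lemma cut_connected_pad:
  assumes fin: "finite V" and sym: "sym A" and D: "D \<subseteq> S" and S: "S \<subseteq> V" "cut_connected A S"
    and dom: "\<And>v. v \<in> V - D \<Longrightarrow> \<exists>u\<in>D. (u, v) \<in> A"
    and k: "card S \<le> k" "k \<le> card V"
  shows "\<exists>S'. S \<subseteq> S' \<and> S' \<subseteq> V \<and> cut_connected A S' \<and> card S' = k"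
  using k
proof (induction k rule: nat_induct_at_least)
  case base
  then show ?case using S by blast
next
  case (Suc k)
  then obtain S' where S': "S \<subseteq> S'" "S' \<subseteq> V" "cut_connected A S'" "card S' = k" by auto
  have "S' \<noteq> V" using S'(4) Suc.prems by auto
  then obtain v where v: "v \<in> V" "v \<notin> S'" using S'(2) by blast
  then have "v \<in> S' \<or> (\<exists>u\<in>S'. (u, v) \<in> A)" using dom[of v] D S'(1) by blast
  with S'(3) sym have "cut_connected A (insert v S')" by (rule cut_connected_insert)
  moreover have "card (insert v S') = Suc k" using v S' fin by (simp add: finite_subset)
  ultimately show ?case using S' v by (intro exI[of _ "insert v S'"]) auto
qed

text \<open>
  Take a connected \<open>S\<close> that contains as many dominators as possible, subject to having at least two vertices
  fewer than three times that number; a single dominator is such a set. If a dominator is missing, then the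
  vertices dominated by \<open>D \<inter> S\<close> and those dominated by \<open>D - S\<close> cover the graph, so that they share a vertex
  or are joined by an edge. Two dominators are thus linked through at most two vertices, and three new
  vertices add a dominator.
\<close>

lemma connected_superset:
  assumes fin: "finite V" and ne: "V \<noteq> {}" and A: "A \<subseteq> V \<times> V" and sym: "sym A"
    and conn: "cut_connected A V" and D: "D \<subseteq> V"
    and dom: "\<And>v. v \<in> V - D \<Longrightarrow> \<exists>u\<in>D. (u, v) \<in> A"
  obtains S where "D \<subseteq> S" "S \<subseteq> V" "cut_connected A S" "card S + 2 \<le> 3 * card D"
proof -
  have finD: "finite D" using D fin finite_subset by blast
  define P where "P S \<longleftrightarrow> S \<subseteq> V \<and> cut_connected A S \<and> card S + 2 \<le> 3 * card (D \<inter> S)" for S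
  have "D \<noteq> {}" using ne dom by blast
  then obtain d where d: "d \<in> D" by blast
  then have "D \<inter> {d} = {d}" by blast
  then have "P {d}" using d D cut_connected_singleton by (auto simp: P_def)
  moreover have "card (D \<inter> S) < Suc (card D)" for S using finD by (simp add: card_mono le_imp_less_Suc)
  ultimately obtain S where S: "P S" "\<And>S'. P S' \<Longrightarrow> card (D \<inter> S') \<le> card (D \<inter> S)"
    using ex_has_greatest_nat[of P "{d}" "\<lambda>S. card (D \<inter> S)" "Suc (card D)"] by blast
  have "D \<subseteq> S"
  proof (rule ccontr)
    assume not: "\<not> D \<subseteq> S"
    define N where "N B = B \<union> A `` B" for B
    have cover: "V \<subseteq> N (D \<inter> S) \<union> N (D - S)" using dom by (fastforce simp: N_def)
    have sub: "N (D \<inter> S) \<subseteq> V" "N (D - S) \<subseteq> V" using A D by (auto simp: N_def)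
    have "D \<inter> S \<noteq> {}" using S(1) by (auto simp: P_def)
    then have ne1: "N (D \<inter> S) \<noteq> {}" by (auto simp: N_def)
    have ne2: "N (D - S) \<noteq> {}" using not by (auto simp: N_def)
    have "\<exists>u\<in>N (D \<inter> S). \<exists>v\<in>N (D - S). u = v \<or> (u, v) \<in> A"
    proof (cases "N (D \<inter> S) \<inter> N (D - S) = {}")
      case True
      then have "N (D \<inter> S) \<subset> V" using sub ne2 by blast
      then have "\<exists>u\<in>N (D \<inter> S). \<exists>v\<in>V - N (D \<inter> S). (u, v) \<in> A" using ne1 by (rule cut_connectedD[OF conn])
      then show ?thesis using cover by blast
    qed blast
    then obtain u v where uv: "u \<in> N (D \<inter> S)" "v \<in> N (D - S)" "u = v \<or> (u, v) \<in> A" by blast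
    obtain d2 where d2: "d2 \<in> D - S" "v = d2 \<or> (v, d2) \<in> A"
      using uv(2) sym unfolding N_def by (blast dest: symD)
    define S' where "S' = insert d2 (insert v (insert u S))"
    have connS: "cut_connected A S" and finS: "finite S"
      using S(1) fin finite_subset by (auto simp: P_def)
    have "u \<in> S \<or> (\<exists>s\<in>S. (s, u) \<in> A)" using uv(1) by (auto simp: N_def)
    with connS sym have "cut_connected A (insert u S)" by (rule cut_connected_insert)
    then have "cut_connected A (insert v (insert u S))"
      using sym by (rule cut_connected_insert) (use uv(3) in blast)
    then have "cut_connected A S'"
      unfolding S'_def using sym by (rule cut_connected_insert) (use d2(2) in blast)
    moreover have "S' \<subseteq> V" using S(1) uv sub d2 D by (auto simp: S'_def P_def)
    moreover have "card S' \<le> card S + 3"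
      unfolding S'_def using finS by (simp add: card_insert_if)
    moreover have more: "card (D \<inter> S) + 1 \<le> card (D \<inter> S')"
    proof -
      have "card (insert d2 (D \<inter> S)) \<le> card (D \<inter> S')"
        using d2 finD by (intro card_mono) (auto simp: S'_def)
      then show ?thesis using d2 finD by simp
    qed
    ultimately have "P S'" using S(1) by (auto simp: P_def)
    then have "card (D \<inter> S') \<le> card (D \<inter> S)" by (rule S(2))
    then show False using more by simp
  qed
  moreover from this have "D \<inter> S = D" by blast
  ultimately show thesis using S(1) by (intro that[of S]) (auto simp: P_def)
qed

lemma colouring_unique:
  assumes conn: "cut_connected A S"
    and c: "\<And>u v. u \<in> S \<Longrightarrow> v \<in> S \<Longrightarrow> (u, v) \<in> A \<Longrightarrow> c u \<noteq> c v"
    and c': "\<And>u v. u \<in> S \<Longrightarrow> v \<in> S \<Longrightarrow> (u, v) \<in> A \<Longrightarrow> c' u \<noteq> c' v"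
  shows "(\<forall>w\<in>S. c' w = c w) \<or> (\<forall>w\<in>S. c' w = (\<not> c w))"
proof (rule ccontr)
  assume not: "\<not> ?thesis"
  define T where "T = {w \<in> S. c' w = c w}"
  have "T \<subset> S" "T \<noteq> {}" using not by (auto simp: T_def)
  then have "\<exists>u\<in>T. \<exists>v\<in>S - T. (u, v) \<in> A" by (rule cut_connectedD[OF conn])
  then obtain u v where "u \<in> T" "v \<in> S - T" "(u, v) \<in> A" by blast
  then show False using c[of u v] c'[of u v] by (auto simp: T_def)
qed

text \<open>
  If \<open>S\<close> is bipartite, its colouring is unique up to exchange of the colours. Give each vertex outside \<open>S\<close>
  the colour opposite to one of its dominators. As the graph is not bipartite, some edge \<open>uv\<close> then has ends of
  the same colour, and adding \<open>u\<close> and \<open>v\<close> to \<open>S\<close> destroys bipartiteness, since all colours are forced.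
\<close>

lemma uncolourable_superset:
  assumes sym: "sym A" and D: "D \<subseteq> S" and S: "S \<subseteq> V" "cut_connected A S"
    and dom: "\<And>v. v \<in> V - D \<Longrightarrow> \<exists>u\<in>D. (u, v) \<in> A" and unc: "\<not> colourable A V" and fin: "finite V"
  obtains S' where "S \<subseteq> S'" "S' \<subseteq> V" "cut_connected A S'" "\<not> colourable A S'" "card S' \<le> card S + 2"
proof (cases "colourable A S")
  case False
  then show thesis using S by (intro that[of S]) auto
next
  case True
  then show thesis
  proof (rule colourableE)
    fix c :: "'a \<Rightarrow> bool"
    assume c: "\<And>u v. u \<in> S \<Longrightarrow> v \<in> S \<Longrightarrow> (u, v) \<in> A \<Longrightarrow> c u \<noteq> c v"
    define f where "f v = (SOME u. u \<in> D \<and> (u, v) \<in> A)" for v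
    have f: "f v \<in> D \<and> (f v, v) \<in> A" if "v \<in> V - S" for v
      unfolding f_def by (rule someI_ex) (use dom[of v] that D in blast)
    define c' where "c' v = (if v \<in> S then c v else \<not> c (f v))" for v
    have "\<not> (\<forall>u\<in>V. \<forall>v\<in>V. (u, v) \<in> A \<longrightarrow> c' u \<noteq> c' v)"
    proof
      assume "\<forall>u\<in>V. \<forall>v\<in>V. (u, v) \<in> A \<longrightarrow> c' u \<noteq> c' v"
      then have "colourable A V" unfolding colourable_def by (rule exI[of _ c'])
      then show False using unc by simp
    qed
    then obtain u v where uv: "u \<in> V" "v \<in> V" "(u, v) \<in> A" "c' u = c' v" by metis
    define S' where "S' = insert v (insert u S)"
    have near: "w \<in> S \<or> (\<exists>s\<in>S. (s, w) \<in> A)" if "w \<in> V" for w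
    proof (cases "w \<in> S")
      case False
      then show ?thesis using f[of w] that D by blast
    qed simp
    have "cut_connected A (insert u S)" using S(2) sym near[OF uv(1)] by (rule cut_connected_insert)
    then have conn: "cut_connected A S'"
      unfolding S'_def using sym by (rule cut_connected_insert) (use near[OF uv(2)] in blast)
    have unc': "\<not> colourable A S'"
    proof
      assume "colourable A S'"
      then show False
      proof (rule colourableE)
        fix e :: "'a \<Rightarrow> bool"
        assume e: "\<And>u v. u \<in> S' \<Longrightarrow> v \<in> S' \<Longrightarrow> (u, v) \<in> A \<Longrightarrow> e u \<noteq> e v"
        have "S \<subseteq> S'" by (auto simp: S'_def)
        then have e_S: "\<And>u v. u \<in> S \<Longrightarrow> v \<in> S \<Longrightarrow> (u, v) \<in> A \<Longrightarrow> e u \<noteq> e v" using e by blast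
        have "(\<forall>w\<in>S. e w = c w) \<or> (\<forall>w\<in>S. e w = (\<not> c w))"
          using S(2) c e_S by (rule colouring_unique)
        then have "(\<forall>w\<in>S. e w = (c w \<noteq> False)) \<or> (\<forall>w\<in>S. e w = (c w \<noteq> True))" by simp
        then obtain s where s: "\<forall>w\<in>S. e w = (c w \<noteq> s)" by (elim disjE) (rule that, assumption)+
        have "e w = (c' w \<noteq> s)" if "w \<in> S'" "w \<in> V" for w
        proof (cases "w \<in> S")
          case True
          then show ?thesis using s by (simp add: c'_def)
        next
          case False
          have fw: "f w \<in> S" "(f w, w) \<in> A" using f[of w] False that D by auto
          then have "e (f w) \<noteq> e w" using e[of "f w" w] that \<open>S \<subseteq> S'\<close> by blast
          then show ?thesis using bspec[OF s fw(1)] False by (auto simp: c'_def)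
        qed
        then have "e u = (c' u \<noteq> s)" "e v = (c' v \<noteq> s)" using uv by (auto simp: S'_def)
        moreover have "e u \<noteq> e v" using uv by (intro e) (auto simp: S'_def)
        ultimately show False using uv(4) by simp
      qed
    qed
    have "card S' \<le> card S + 2"
      unfolding S'_def using S(1) fin by (auto simp: card_insert_if finite_subset)
    then show thesis using conn unc' uv S(1) by (intro that[of S']) (auto simp: S'_def)
  qed
qed

lemma dominated_core_exists:
  assumes fin: "finite V" and ne: "V \<noteq> {}" and A: "A \<subseteq> V \<times> V" and sym: "sym A"
    and conn: "cut_connected A V" and unc: "\<not> colourable A V" and D: "D \<subseteq> V"
    and dom: "\<And>v. v \<in> V - D \<Longrightarrow> \<exists>u\<in>D. (u, v) \<in> A" and le: "3 * card D \<le> card V"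
  obtains S where "D \<subseteq> S" "S \<subseteq> V" "cut_connected A S" "\<not> colourable A S" "card S = 3 * card D"
proof -
  obtain S0 where S0: "D \<subseteq> S0" "S0 \<subseteq> V" "cut_connected A S0" "card S0 + 2 \<le> 3 * card D"
    by (rule connected_superset[OF fin ne A sym conn D dom])
  obtain S1 where S1: "S0 \<subseteq> S1" "S1 \<subseteq> V" "cut_connected A S1" "\<not> colourable A S1" "card S1 \<le> card S0 + 2"
    by (rule uncolourable_superset[OF sym S0(1-3) dom unc fin])
  have "D \<subseteq> S1" "card S1 \<le> 3 * card D" using S0 S1 by auto
  then obtain S where S: "S1 \<subseteq> S" "S \<subseteq> V" "cut_connected A S" "card S = 3 * card D"
    using cut_connected_pad[OF fin sym _ S1(2,3) dom _ le] by blast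
  show thesis using that[of S] S \<open>D \<subseteq> S1\<close> uncolourable_mono[OF S(1) S1(4)] by blast
qed

lemma bipartite_iff_colourable:
  assumes A: "parcs G \<subseteq> pverts G \<times> pverts G"
  shows "bipartite G \<longleftrightarrow> colourable (parcs G) (pverts G)"
proof
  assume "bipartite G"
  then obtain X Y where XY: "X \<union> Y = pverts G" "X \<inter> Y = {}"
      "\<forall>(u, v)\<in>parcs G. (u \<in> X \<and> v \<in> Y) \<or> (u \<in> Y \<and> v \<in> X)"
    unfolding bipartite_def by (elim exE conjE) (rule that)
  show "colourable (parcs G) (pverts G)"
    unfolding colourable_def
  proof (intro exI[of _ "\<lambda>v. v \<in> X"] ballI impI)
    fix u v assume "(u, v) \<in> parcs G"
    then have "(u \<in> X \<and> v \<in> Y) \<or> (u \<in> Y \<and> v \<in> X)" using bspec[OF XY(3)] by fastforce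
    then show "(u \<in> X) \<noteq> (v \<in> X)" using XY(2) by blast
  qed
next
  assume "colourable (parcs G) (pverts G)"
  then show "bipartite G"
  proof (rule colourableE)
    fix c :: "'a \<Rightarrow> bool"
    assume c: "\<And>u v. u \<in> pverts G \<Longrightarrow> v \<in> pverts G \<Longrightarrow> (u, v) \<in> parcs G \<Longrightarrow> c u \<noteq> c v"
    show "bipartite G" unfolding bipartite_def
    proof (rule exI[of _ "{v \<in> pverts G. c v}"], rule exI[of _ "{v \<in> pverts G. \<not> c v}"], intro conjI)
      show "\<forall>(u, v)\<in>parcs G. u \<in> {v \<in> pverts G. c v} \<and> v \<in> {v \<in> pverts G. \<not> c v} \<or>
          u \<in> {v \<in> pverts G. \<not> c v} \<and> v \<in> {v \<in> pverts G. c v}"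
      proof (rule ballI)
        fix e assume e: "e \<in> parcs G"
        obtain u v where uv: "e = (u, v)" by fastforce
        have V: "u \<in> pverts G" "v \<in> pverts G" using A e uv by auto
        then have "c u \<noteq> c v" using e uv by (intro c) auto
        then show "case e of (u, v) \<Rightarrow> u \<in> {v \<in> pverts G. c v} \<and> v \<in> {v \<in> pverts G. \<not> c v} \<or>
          u \<in> {v \<in> pverts G. \<not> c v} \<and> v \<in> {v \<in> pverts G. c v}" using V uv by auto
      qed
    qed auto
  qed
qed

lemma connected_iff_cut_connected:
  assumes A: "parcs G \<subseteq> pverts G \<times> pverts G" and sym: "sym (parcs G)"
  shows "Digraph_Component.connected (with_proj G) \<longleftrightarrow>
    pverts G \<noteq> {} \<and> cut_connected (parcs G) (pverts G)"
proof -
  define V where "V = pverts G"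
  define R where "R = rtrancl_on V (parcs G)"
  have "(\<lambda>(a, b). (b, a)) ` parcs G \<subseteq> parcs G"
  proof clarify
    fix u v assume "(v, u) \<in> parcs G"
    then show "(u, v) \<in> parcs G" by (rule symD[OF sym])
  qed
  then have "(parcs G)\<^sup>s = parcs G" unfolding symcl_def by (rule Un_absorb2)
  then have "Digraph_Component.connected (with_proj G) \<longleftrightarrow> V \<noteq> {} \<and> (\<forall>u\<in>V. \<forall>v\<in>V. (u, v) \<in> R)"
    by (simp add: connected_conv V_def R_def)
  moreover have "(\<forall>u\<in>V. \<forall>v\<in>V. (u, v) \<in> R) \<longleftrightarrow> cut_connected (parcs G) V"
  proof
    assume all: "\<forall>u\<in>V. \<forall>v\<in>V. (u, v) \<in> R"
    show "cut_connected (parcs G) V"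
    proof (rule cut_connectedI, rule ccontr)
      fix T assume T: "T \<subset> V" "T \<noteq> {}" and no: "\<not> (\<exists>u\<in>T. \<exists>v\<in>V - T. (u, v) \<in> parcs G)"
      obtain u where "u \<in> T" using T by blast
      moreover obtain v where "v \<in> V - T" using T by blast
      ultimately have uv: "u \<in> T" "v \<in> V - T" by auto
      have "u \<in> V" "v \<in> V" using uv T by auto
      then have "(u, v) \<in> rtrancl_on V (parcs G)" using all unfolding R_def by simp
      then have "v \<in> T"
      proof (induction rule: rtrancl_on_induct)
        case base
        show ?case by (rule uv(1))
      next
        case (step y z)
        then show ?case using no by blast
      qed
      then show False using uv by simp
    qed
  next
    assume conn: "cut_connected (parcs G) V"
    show "\<forall>u\<in>V. \<forall>v\<in>V. (u, v) \<in> R"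
    proof (intro ballI)
      fix u v assume uv: "u \<in> V" "v \<in> V"
      define T where "T = {w \<in> V. (u, w) \<in> R}"
      have u: "u \<in> T" using uv by (simp add: T_def R_def)
      have "T = V"
      proof (rule ccontr)
        assume "T \<noteq> V"
        then have "T \<subset> V" by (auto simp: T_def)
        moreover have "T \<noteq> {}" using u by blast
        ultimately have "\<exists>a\<in>T. \<exists>b\<in>V - T. (a, b) \<in> parcs G" by (rule cut_connectedD[OF conn])
        then obtain a b where ab: "a \<in> T" "b \<in> V - T" "(a, b) \<in> parcs G" by blast
        have ua: "(u, a) \<in> R" and b: "b \<in> V" using ab by (auto simp: T_def)
        have "(u, b) \<in> R" using ua ab(3) b unfolding R_def by (rule rtrancl_on_into_rtrancl_on)
        then show False using ab by (simp add: T_def)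
      qed
      then show "(u, v) \<in> R" using uv by (auto simp: T_def)
    qed
  qed
  ultimately show ?thesis by (simp add: V_def)
qed

section \<open>The graphs \<open>Cstar n 3 l\<close>\<close>

lemma kite_edges_sub: "3 \<le> m \<Longrightarrow> m \<le> n \<Longrightarrow> kite_edges n m \<subseteq> {(i, j). i < j \<and> j < n}"
  by (auto simp: kite_edges_def)

lemma Cstar_arcs:
  assumes "3 \<le> m"
  shows "parcs (Cstar n 3 (m - 3)) = kite_edges n m \<union> (kite_edges n m)\<inverse>"
proof -
  have cyc: "{(i, Suc i mod 3) | i. i < 3} = {(0, 1), (1, 2), (2, 0)}"
  proof -
    have "{i :: nat. i < 3} = {0, 1, 2}" by auto
    then show ?thesis unfolding setcompr_eq_image by (simp add: numeral_2_eq_2)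
  qed
  have path: "{(i, Suc i) | i. 3 - 1 \<le> i \<and> i < 3 + (m - 3) - 1} = {(i, Suc i) | i. 2 \<le> i \<and> Suc i < m}"
    using assms by auto
  have pend: "{(3 + (m - 3) - 1, j) | j. 3 + (m - 3) \<le> j \<and> j < n} = {(m - 1, j) | j. m \<le> j \<and> j < n}"
    using assms by auto
  define P where "P = {(i, Suc i) | i. 2 \<le> i \<and> Suc i < m}"
  define L where "L = {(m - 1, j) | j. m \<le> j \<and> j < n}"
  show ?thesis
    unfolding Cstar_def Cstar_edges_def pair_pre_digraph.simps cyc path pend kite_edges_def P_def[symmetric] L_def[symmetric]
    by auto
qed

lemma Cstar_verts: "pverts (Cstar n 3 l) = {..<n}" by (simp add: Cstar_def)

lemma kite_edges_iff:
  "(u, v) \<in> kite_edges n m \<longleftrightarrow> (u = 0 \<and> v = 1) \<or> (u = 0 \<and> v = 2) \<or> (u = 1 \<and> v = 2) \<or>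
     (2 \<le> u \<and> v = Suc u \<and> v < m) \<or> (u = m - 1 \<and> m \<le> v \<and> v < n)"
  by (auto simp: kite_edges_def)

lemma kite_edges_last:
  assumes "4 \<le> n"
  shows "kite_edges n (n - 1) = kite_edges n n"
proof -
  have "(u, v) \<in> kite_edges n (n - 1) \<longleftrightarrow> (u, v) \<in> kite_edges n n" for u v
    unfolding kite_edges_iff using assms by presburger
  then show ?thesis by (intro equalityI subrelI) simp_all
qed

text \<open>A single pendant vertex at the end of the path is one more path vertex. For \<open>n = 3\<close> both sides are the
  triangle, as subtraction truncates.\<close>

lemma Cstar_last: "3 \<le> n \<Longrightarrow> Cstar n 3 (n - 4) = Cstar n 3 (n - 3)"
proof (cases "n = 3")
  case False
  assume "3 \<le> n"
  then have n: "4 \<le> n" using False by simp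
  have "parcs (Cstar n 3 (n - 1 - 3)) = parcs (Cstar n 3 (n - 3))"
    using Cstar_arcs[of "n - 1" n] Cstar_arcs[of n n] kite_edges_last[OF n] n by simp
  then show ?thesis using n by (simp add: Cstar_def)
qed simp

context
  fixes n m :: nat
  assumes m: "3 \<le> m" and mn: "m \<le> n"
begin

lemma pair_graph_Cstar: "pair_graph (Cstar n 3 (m - 3))"
proof -
  have sub: "parcs (Cstar n 3 (m - 3)) \<subseteq> {..<n} \<times> {..<n}"
    unfolding Cstar_arcs[OF m] using kite_edges_sub[OF m mn] by auto
  then have fin: "finite (parcs (Cstar n 3 (m - 3)))" by (rule finite_subset) simp
  show ?thesis
  proof
    show "fst e \<in> pverts (Cstar n 3 (m - 3))" "snd e \<in> pverts (Cstar n 3 (m - 3))"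
      if "e \<in> parcs (Cstar n 3 (m - 3))" for e using sub that by (auto simp: Cstar_verts)
    show "finite (pverts (Cstar n 3 (m - 3)))" by (simp add: Cstar_verts)
    show "finite (parcs (Cstar n 3 (m - 3)))" by (rule fin)
    show "fst e \<noteq> snd e" if "e \<in> parcs (Cstar n 3 (m - 3))" for e
      using that kite_edges_sub[OF m mn] unfolding Cstar_arcs[OF m] by auto
    show "symmetric (with_proj (Cstar n 3 (m - 3)))"
      unfolding symmetric_def with_proj_simps Cstar_arcs[OF m] by (rule sym_Un_converse)
  qed
qed

lemma labelled_edges_Cstar: "labelled_edges (parcs (Cstar n 3 (m - 3))) id n = kite_edges n m"
  unfolding labelled_edges_def Cstar_arcs[OF m] using kite_edges_sub[OF m mn] by auto

lemma energy_Cstar: "energy (parcs (Cstar n 3 (m - 3))) x / 2 = energy (kite_edges n m) x"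
proof -
  note arcs = pair_graph_arcs[OF pair_graph_Cstar]
  have "energy (parcs (Cstar n 3 (m - 3))) x = 2 * energy (labelled_edges (parcs (Cstar n 3 (m - 3))) id n) (x \<circ> id)"
    by (rule energy_labelled_edges[OF arcs(2,3,4)]) (simp add: Cstar_verts)
  then show ?thesis by (simp add: labelled_edges_Cstar)
qed

lemma energy_kite_edges:
  "energy (kite_edges n m) x = (x 0 + x 1)\<^sup>2 + (x 0 + x 2)\<^sup>2 + (x 1 + x 2)\<^sup>2 +
     (\<Sum>i = 2..<m - 1. (x i + x (Suc i))\<^sup>2) + (\<Sum>j = m..<n. (x (m - 1) + x j)\<^sup>2)"
proof -
  define T P L where "T = {(0 :: nat, 1), (0, 2), (1, 2 :: nat)}" and "P = (\<lambda>i. (i, Suc i)) ` {2..<m - 1}"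
    and "L = (\<lambda>j. (m - 1, j)) ` {m..<n}"
  have eq: "kite_edges n m = (T \<union> P) \<union> L" using m by (auto simp: kite_edges_def T_def P_def L_def)
  have disj: "T \<inter> P = {}" "(T \<union> P) \<inter> L = {}" using m by (auto simp: T_def P_def L_def)
  have fin: "finite T" "finite P" "finite L" by (auto simp: T_def P_def L_def)
  have "energy (kite_edges n m) x = energy T x + energy P x + energy L x"
    unfolding eq energy_def using fin disj by (simp add: sum.union_disjoint)
  moreover have "energy T x = (x 0 + x 1)\<^sup>2 + (x 0 + x 2)\<^sup>2 + (x 1 + x 2)\<^sup>2" by (simp add: energy_def T_def)
  moreover have "energy P x = (\<Sum>i = 2..<m - 1. (x i + x (Suc i))\<^sup>2)"
    unfolding energy_def P_def by (subst sum.reindex) (auto simp: inj_on_def)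
  moreover have "energy L x = (\<Sum>j = m..<n. (x (m - 1) + x j)\<^sup>2)"
    unfolding energy_def L_def by (subst sum.reindex) (auto simp: inj_on_def)
  ultimately show ?thesis by simp
qed

text \<open>The signs are equal at \<open>0\<close> and \<open>1\<close> and alternate along every other edge.\<close>

lemma kite_form_ge:
  "least_Q_eigenvalue (Cstar n 3 (m - 3)) * (\<Sum>i<n. (w i)\<^sup>2) \<le> kite_form n m w"
proof -
  define s where "s i = (if i = 0 then 1 else if i < m then (-1) ^ (i - 1) else (-1) ^ (m - 1) :: real)" for i
  have s2: "(s i)\<^sup>2 = 1" for i by (simp add: s_def power_mult[symmetric] power2_eq_square[symmetric] power_even_eq)
  have flip: "(s i * a + s j * b)\<^sup>2 = (b - a)\<^sup>2" if "s j = - s i" for i j and a b :: real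
  proof -
    have "(s i * a + s j * b)\<^sup>2 = (s i)\<^sup>2 * (b - a)\<^sup>2" unfolding that by (simp add: power2_eq_square algebra_simps)
    then show ?thesis by (simp add: s2)
  qed
  have sgn: "s 0 = 1" "s 1 = 1" "s 2 = - s 0" "s 2 = - s 1" using m by (simp_all add: s_def)
  have path: "s (Suc i) = - s i" if "i \<in> {2..<m - 1}" for i
  proof -
    have "i = Suc (i - 1)" using that by simp
    then have "(-1) ^ i = - ((-1) ^ (i - 1) :: real)" by (metis power_Suc mult_minus1)
    moreover have "i < m" "Suc i < m" "i \<noteq> 0" using that by auto
    ultimately show ?thesis by (simp add: s_def)
  qed
  have leaf: "s j = - s (m - 1)" if "j \<in> {m..<n}" for j
  proof -
    have "m - 1 = Suc (m - 1 - 1)" using m by simp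
    then have "(-1) ^ (m - 1) = - ((-1) ^ (m - 1 - 1) :: real)" by (metis power_Suc mult_minus1)
    then show ?thesis using that m by (simp add: s_def)
  qed
  have "least_Q_eigenvalue (Cstar n 3 (m - 3)) * (\<Sum>i<n. (s i * w i)\<^sup>2) \<le> energy (kite_edges n m) (\<lambda>i. s i * w i)"
    using least_Q_eigenvalue_rayleigh(1)[OF pair_graph_Cstar, of "\<lambda>i. s i * w i"] m mn
    by (simp add: Cstar_verts energy_Cstar lessThan_empty_iff)
  also have "energy (kite_edges n m) (\<lambda>i. s i * w i) = kite_form n m w"
    unfolding energy_kite_edges kite_form_def
    using flip[OF sgn(3)] flip[OF sgn(4)] flip[OF path] flip[OF leaf] by (simp add: sgn(1,2) sgn(2)[unfolded One_nat_def])
  finally show ?thesis by (simp add: power_mult_distrib s2)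
qed

text \<open>A vector of energy zero changes its sign along every edge, so that it vanishes on the triangle and then
  everywhere.\<close>

lemma least_Q_eigenvalue_Cstar_pos: "0 < least_Q_eigenvalue (Cstar n 3 (m - 3))"
proof (rule ccontr)
  assume not: "\<not> ?thesis"
  have "pverts (Cstar n 3 (m - 3)) \<noteq> {}" using m mn by (auto simp: Cstar_verts lessThan_empty_iff)
  then obtain x where x: "\<exists>v\<in>{..<n}. x v \<noteq> 0"
    "energy (kite_edges n m) x = least_Q_eigenvalue (Cstar n 3 (m - 3)) * (\<Sum>v<n. (x v)\<^sup>2)"
    using least_Q_eigenvalue_rayleigh(2)[OF pair_graph_Cstar] by (auto simp: Cstar_verts energy_Cstar)
  have "least_Q_eigenvalue (Cstar n 3 (m - 3)) * (\<Sum>v<n. (x v)\<^sup>2) \<le> 0"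
    using not by (intro mult_nonpos_nonneg sum_nonneg) auto
  then have "energy (kite_edges n m) x \<le> 0" using x(2) by simp
  moreover have P: "0 \<le> (\<Sum>i = 2..<m - 1. (x i + x (Suc i))\<^sup>2)" "0 \<le> (\<Sum>j = m..<n. (x (m - 1) + x j)\<^sup>2)"
    by (auto intro: sum_nonneg)
  ultimately have tri: "(x 0 + x 1)\<^sup>2 \<le> 0" "(x 0 + x 2)\<^sup>2 \<le> 0" "(x 1 + x 2)\<^sup>2 \<le> 0"
    and sums: "(\<Sum>i = 2..<m - 1. (x i + x (Suc i))\<^sup>2) = 0" "(\<Sum>j = m..<n. (x (m - 1) + x j)\<^sup>2) = 0"
    using zero_le_power2[of "x 0 + x 1"] zero_le_power2[of "x 0 + x 2"] zero_le_power2[of "x 1 + x 2"]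
    unfolding energy_kite_edges by linarith+
  have low: "x 0 = 0" "x 1 = 0" "x 2 = 0" using tri by auto
  have "\<forall>i\<in>{2..<m - 1}. (x i + x (Suc i))\<^sup>2 = 0" using sums(1) by (subst (asm) sum_nonneg_eq_0_iff) auto
  then have step: "x i + x (Suc i) = 0" if "2 \<le> i" "Suc i < m" for i using that by auto
  have path: "x i = 0" if "2 \<le> i" "i < m" for i
    using that
  proof (induction i rule: nat_induct_at_least)
    case (Suc i)
    then show ?case using step[of i] by simp
  qed (rule low(3))
  have "\<forall>j\<in>{m..<n}. (x (m - 1) + x j)\<^sup>2 = 0" using sums(2) by (subst (asm) sum_nonneg_eq_0_iff) auto
  then have leaf: "x j = 0" if "m \<le> j" "j < n" for j using that path[of "m - 1"] m by auto
  have "x i = 0" if "i < n" for i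
  proof -
    have "i = 0 \<or> i = 1 \<or> (2 \<le> i \<and> i < m) \<or> m \<le> i" by linarith
    then show ?thesis using low path leaf that by auto
  qed
  then show False using x(1) by auto
qed

lemma least_Q_eigenvalue_Cstar_less_1:
  assumes "4 \<le> n"
  shows "least_Q_eigenvalue (Cstar n 3 (m - 3)) < 1"
proof -
  \<comment> \<open>A vector of energy \<open>6\<close> whose squared norm is \<open>6\<close> for the triangle and larger for \<open>n \<ge> 4\<close>.\<close>
  define w :: "nat \<Rightarrow> real" where "w i = (if i < 2 then 1 else 2)" for i
  have "(\<Sum>i = 2..<m - 1. (w (Suc i) - w i)\<^sup>2) = 0" "(\<Sum>j = m..<n. (w j - w (m - 1))\<^sup>2) = 0"
    using m by (auto simp: w_def intro!: sum.neutral)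
  then have form: "kite_form n m w = 6" by (simp add: kite_form_def w_def)
  have "{..<n} = {0, 1} \<union> {2..<n}" using assms by auto
  then have "(\<Sum>i<n. (w i)\<^sup>2) = (\<Sum>i\<in>{0, 1}. (w i)\<^sup>2) + (\<Sum>i = 2..<n. (w i)\<^sup>2)"
    by (simp only:) (subst sum.union_disjoint, auto)
  also have "\<dots> = 2 + 4 * (real n - 2)" using assms by (simp add: w_def)
  finally have sum: "(\<Sum>i<n. (w i)\<^sup>2) = 4 * real n - 6" by simp
  then have big: "6 < (\<Sum>i<n. (w i)\<^sup>2)" using assms by simp
  show ?thesis
  proof (rule ccontr)
    assume "\<not> ?thesis"
    then have "1 * (\<Sum>i<n. (w i)\<^sup>2) \<le> least_Q_eigenvalue (Cstar n 3 (m - 3)) * (\<Sum>i<n. (w i)\<^sup>2)"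
      by (intro mult_right_mono sum_nonneg) auto
    then show False using kite_form_ge[of w] form big by linarith
  qed
qed

lemma connected_Cstar: "Digraph_Component.connected (with_proj (Cstar n 3 (m - 3)))"
proof -
  note arcs = pair_graph_arcs[OF pair_graph_Cstar]
  have nbr: "\<exists>u<k. (u, k) \<in> parcs (Cstar n 3 (m - 3))" if "1 \<le> k" "k < n" for k
  proof -
    have "(if k < 3 then 0 else min (k - 1) (m - 1), k) \<in> kite_edges n m"
      unfolding kite_edges_iff using that m by (auto simp: min_def)
    moreover have "(if k < 3 then 0 else min (k - 1) (m - 1)) < k" using that by (simp add: min_def) arith
    ultimately have "\<exists>u<k. (u, k) \<in> kite_edges n m" by blast
    then show ?thesis unfolding Cstar_arcs[OF m] by blast
  qed
  have "cut_connected (parcs (Cstar n 3 (m - 3))) {..<k}" if "1 \<le> k" "k \<le> n" for k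
    using that
  proof (induction k rule: nat_induct_at_least)
    case base
    have "{..<1} = {0 :: nat}" by auto
    then show ?case using cut_connected_singleton by simp
  next
    case (Suc k)
    have "cut_connected (parcs (Cstar n 3 (m - 3))) {..<k}" using Suc by simp
    moreover have "\<exists>u\<in>{..<k}. (u, k) \<in> parcs (Cstar n 3 (m - 3))" using nbr[of k] Suc by auto
    ultimately have "cut_connected (parcs (Cstar n 3 (m - 3))) (insert k {..<k})"
      using arcs(3) by (intro cut_connected_insert) auto
    then show ?case by (simp add: lessThan_Suc)
  qed
  from this[of n] show ?thesis
    unfolding connected_iff_cut_connected[OF arcs(2,3)] using m mn by (auto simp: Cstar_verts lessThan_empty_iff)
qed

lemma not_bipartite_Cstar: "\<not> bipartite (Cstar n 3 (m - 3))"
proof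
  note arcs = pair_graph_arcs[OF pair_graph_Cstar]
  assume "bipartite (Cstar n 3 (m - 3))"
  then have "colourable (parcs (Cstar n 3 (m - 3))) {..<n}"
    using bipartite_iff_colourable[OF arcs(2)] by (simp add: Cstar_verts)
  then show False
  proof (rule colourableE)
    fix c :: "nat \<Rightarrow> bool"
    assume c: "\<And>u v. u \<in> {..<n} \<Longrightarrow> v \<in> {..<n} \<Longrightarrow> (u, v) \<in> parcs (Cstar n 3 (m - 3)) \<Longrightarrow> c u \<noteq> c v"
    have tri: "(0, 1) \<in> parcs (Cstar n 3 (m - 3))" "(0, 2) \<in> parcs (Cstar n 3 (m - 3))" "(1, 2) \<in> parcs (Cstar n 3 (m - 3))"
      unfolding Cstar_arcs[OF m] by (auto simp: kite_edges_def)
    have "c 0 \<noteq> c 1" by (rule c[OF _ _ tri(1)]) (use m mn in auto)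
    moreover have "c 0 \<noteq> c 2" by (rule c[OF _ _ tri(2)]) (use m mn in auto)
    moreover have "c 1 \<noteq> c 2" by (rule c[OF _ _ tri(3)]) (use m mn in auto)
    ultimately show False by auto
  qed
qed

text \<open>
  The vertices \<open>2, 5, 8, \<dots>\<close>, the last one replaced by \<open>m - 1\<close> if it exceeds that, are dominating. Conversely,
  the closed neighbourhoods of \<open>0, 4, 7, \<dots>, 3 * g - 2\<close> are disjoint, because the \<open>k\<close>-th of them consists of
  vertices \<open>d\<close> with \<open>d div 3 = k\<close>.
\<close>

lemma domination_number_Cstar:
  assumes g: "1 \<le> g" "3 * g - 1 \<le> m" "m \<le> 3 * g + 1" and last: "m = n \<or> m = 3 * g"
  shows "domination_number (Cstar n 3 (m - 3)) = g"
proof -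
  define A where "A = parcs (Cstar n 3 (m - 3))"
  have A: "(u, v) \<in> A \<longleftrightarrow> (u, v) \<in> kite_edges n m \<or> (v, u) \<in> kite_edges n m" for u v
    unfolding A_def Cstar_arcs[OF m] by auto
  have dom_def: "dominating_set (Cstar n 3 (m - 3)) D \<longleftrightarrow>
      D \<subseteq> {..<n} \<and> (\<forall>v\<in>{..<n} - D. \<exists>u\<in>D. (v, u) \<in> A)" for D
    by (simp add: dominating_set_def Cstar_verts A_def)
  have fin: "finite {D. dominating_set (Cstar n 3 (m - 3)) D}"
    by (rule finite_subset[of _ "Pow {..<n}"]) (auto simp: dom_def)
  have lower: "g \<le> card D" if D: "dominating_set (Cstar n 3 (m - 3)) D" for D
  proof -
    have finD: "finite D" using D by (auto simp: dom_def intro: finite_subset)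
    have "{..<g} \<subseteq> (\<lambda>d. d div 3) ` D"
    proof
      fix k assume "k \<in> {..<g}"
      then have k: "k < g" by simp
      \<comment> \<open>A vertex whose closed neighbourhood lies in the \<open>k\<close>-th block of three. A pendant vertex could only
        spoil this at \<open>v = m - 1\<close>, which forces \<open>m = 3 * g - 1\<close> and hence \<open>m = n\<close>.\<close>
      define v where "v = (if k = 0 then 0 else 3 * k + 1)"
      have v: "v < m" using k g m by (auto simp: v_def)
      have v3: "v div 3 = k" unfolding v_def by presburger
      show "k \<in> (\<lambda>d. d div 3) ` D"
      proof (cases "v \<in> D")
        case True
        then show ?thesis using v3 by blast
      next
        case False
        then have "v \<in> {..<n} - D" using v mn by simp
        then obtain u where u: "u \<in> D" "(v, u) \<in> A" using D unfolding dom_def by blast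
        have "u div 3 = k"
        proof (cases "k = 0")
          case True
          then have "u = 1 \<or> u = 2" using u(2) m by (auto simp: A v_def kite_edges_iff)
          then show ?thesis using True by auto
        next
          case False
          then have v_eq: "v = 3 * k + 1" by (simp add: v_def)
          have "u = v + 1 \<or> v = u + 1"
          proof -
            have "(v, u) \<in> kite_edges n m \<or> (u, v) \<in> kite_edges n m" using u(2) by (simp add: A)
            moreover have "v = m - 1 \<Longrightarrow> m = n" using v_eq k last m by presburger
            ultimately show ?thesis using v v_eq False m unfolding kite_edges_iff by linarith
          qed
          then show ?thesis using v_eq by presburger
        qed
        then show ?thesis using u(1) by blast
      qed
    qed
    then have "card {..<g} \<le> card ((\<lambda>d. d div 3) ` D)" using finD by (intro card_mono) auto
    also have "\<dots> \<le> card D" using finD by (rule card_image_le)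
    finally show ?thesis by simp
  qed
  define D where "D = (\<lambda>k. min (3 * k + 2) (m - 1)) ` {..<g}"
  have D: "dominating_set (Cstar n 3 (m - 3)) D"
    unfolding dom_def
  proof (intro conjI ballI)
    show "D \<subseteq> {..<n}" using m mn by (auto simp: D_def)
    fix v assume v: "v \<in> {..<n} - D"
    have inD: "3 * k + 2 \<in> D" if "k < g" "3 * k + 2 < m" for k
      using that by (auto simp: D_def intro!: image_eqI[of _ _ k])
    have two: "2 \<in> D" using inD[of 0] g m by (simp add: numeral_2_eq_2)
    have lastD: "m - 1 \<in> D" if "m \<le> 3 * g"
      using that g m by (auto simp: D_def intro!: image_eqI[of _ _ "g - 1"])
    have up: "(v, u) \<in> A" if "u = v + 1" "2 \<le> v" "u < m" for u
      using that by (auto simp: A kite_edges_iff)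
    have down: "(v, u) \<in> A" if "v = u + 1" "2 \<le> u" "v < m" for u
      using that by (auto simp: A kite_edges_iff)
    show "\<exists>u\<in>D. (v, u) \<in> A"
    proof (cases "v < m")
      case False
      then have "m = 3 * g" using last v by auto
      then show ?thesis using lastD v False by (intro bexI[of _ "m - 1"]) (auto simp: A kite_edges_iff)
    next
      case vm: True
      define k where "k = v div 3"
      consider "v = 3 * k" | "v = 3 * k + 1" | "v = 3 * k + 2" unfolding k_def by linarith
      then show ?thesis
      proof cases
        case 1
        show ?thesis
        proof (cases "k = 0")
          case True
          then show ?thesis using 1 two m by (intro bexI[of _ 2]) (auto simp: A kite_edges_iff)
        next
          case False
          then have "3 * (k - 1) + 2 \<in> D" using 1 vm g by (intro inD) auto
          moreover have "(v, 3 * (k - 1) + 2) \<in> A" using 1 False vm by (intro down) auto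
          ultimately show ?thesis by blast
        qed
      next
        case 2
        show ?thesis
        proof (cases "k = 0")
          case True
          then show ?thesis using 2 two m by (intro bexI[of _ 2]) (auto simp: A kite_edges_iff)
        next
          case False
          show ?thesis
          proof (cases "v = m - 1")
            case True
            then have "m = 3 * k + 2" using 2 m by simp
            then have "m \<le> 3 * g" using g by presburger
            then show ?thesis using lastD True v by simp
          next
            case nl: False
            then have "3 * k + 2 \<in> D" using 2 vm g by (intro inD) auto
            moreover have "(v, 3 * k + 2) \<in> A" using 2 False vm nl by (intro up) auto
            ultimately show ?thesis by blast
          qed
        qed
      next
        case 3
        then have "v \<in> D" using inD[of k] vm g by auto
        then show ?thesis using v by simp
      qed
    qed
  qed
  have "card D \<le> g" using card_image_le[of "{..<g}" "\<lambda>k. min (3 * k + 2) (m - 1)"] by (simp add: D_def)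
  then have "card D = g" using lower[OF D] by simp
  then show ?thesis unfolding domination_number_def
    using fin lower D by (intro Min_eqI) auto
qed

end

section \<open>Comparison with \<open>Cstar\<close> and the extremal graphs\<close>

lemma digraph_iso_CstarI:
  assumes G: "pair_graph G" and m: "3 \<le> m" and mn: "m \<le> n" and bij: "bij_betw h {..<n} (pverts G)"
    and edges: "labelled_edges (parcs G) h n = kite_edges n m"
  shows "digraph_iso (with_proj G) (with_proj (Cstar n 3 (m - 3)))"
proof -
  interpret pair_graph G by (rule G)
  note arcs = pair_graph_arcs[OF G]
  define g where "g = the_inv_into {..<n} h"
  have bij_g: "bij_betw g (pverts G) {..<n}" unfolding g_def using bij by (rule bij_betw_the_inv_into)
  have gh: "g (h i) = i" if "i < n" for i
    using bij that by (simp add: g_def the_inv_into_f_f bij_betw_def)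
  have hg: "h (g v) = v" "g v < n" if "v \<in> pverts G" for v
  proof -
    show "h (g v) = v" using bij that by (simp add: g_def f_the_inv_into_f bij_betw_def)
    show "g v < n" using bij_g that by (auto simp: bij_betw_def)
  qed
  define F where "F = \<lparr>iso_verts = g, iso_arcs = (\<lambda>e. (g (fst e), g (snd e))), iso_head = snd, iso_tail = fst\<rparr>"
  have key: "(h i, h j) \<in> parcs G \<longleftrightarrow> (i, j) \<in> kite_edges n m \<or> (j, i) \<in> kite_edges n m" if "i < n" "j < n" for i j
  proof -
    have "(h j, h i) \<in> parcs G \<longleftrightarrow> (h i, h j) \<in> parcs G" using arcs(3) by (blast dest: symD)
    moreover have "i \<noteq> j" if "(h i, h j) \<in> parcs G" using that arcs(4) by (auto simp: irrefl_def)
    ultimately show ?thesis unfolding edges[symmetric] labelled_edges_def using that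
      by (cases i j rule: linorder_cases) auto
  qed
  have "inj_on (\<lambda>e. (g (fst e), g (snd e))) (parcs G)"
  proof (rule inj_onI)
    fix e e' assume e: "e \<in> parcs G" "e' \<in> parcs G" "(g (fst e), g (snd e)) = (g (fst e'), g (snd e'))"
    have "inj_on g (pverts G)" using bij_g by (simp add: bij_betw_def)
    moreover have "fst e \<in> pverts G" "snd e \<in> pverts G" "fst e' \<in> pverts G" "snd e' \<in> pverts G"
      using e(1,2) arcs(2) by auto
    ultimately have "fst e = fst e'" "snd e = snd e'" using e(3) by (auto dest: inj_onD)
    then show "e = e'" by (rule prod_eqI)
  qed
  then have "pre_digraph.digraph_isomorphism (with_proj G) F"
    unfolding pre_digraph.digraph_isomorphism_def F_def using bij_g wf_digraph_axioms by (simp add: bij_betw_def)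
  moreover have "with_proj (Cstar n 3 (m - 3)) = app_iso F (with_proj G)"
  proof -
    have "parcs (Cstar n 3 (m - 3)) = (\<lambda>e. (g (fst e), g (snd e))) ` parcs G"
    proof (intro equalityI subsetI)
      fix e assume e: "e \<in> parcs (Cstar n 3 (m - 3))"
      obtain i j where ij: "e = (i, j)" by fastforce
      have "(i, j) \<in> kite_edges n m \<or> (j, i) \<in> kite_edges n m" using e ij unfolding Cstar_arcs[OF m] by auto
      moreover from this have lt: "i < n" "j < n" using kite_edges_sub[OF m mn] by auto
      ultimately have "(h i, h j) \<in> parcs G" using key by simp
      then show "e \<in> (\<lambda>e. (g (fst e), g (snd e))) ` parcs G"
        using gh[OF lt(1)] gh[OF lt(2)] ij by (intro image_eqI[of _ _ "(h i, h j)"]) auto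
    next
      fix e assume "e \<in> (\<lambda>e. (g (fst e), g (snd e))) ` parcs G"
      then obtain u v where uv: "(u, v) \<in> parcs G" "e = (g u, g v)" by auto
      have V: "u \<in> pverts G" "v \<in> pverts G" using uv arcs(2) by auto
      have "(h (g u), h (g v)) \<in> parcs G" using uv(1) hg V by simp
      then show "e \<in> parcs (Cstar n 3 (m - 3))"
        unfolding Cstar_arcs[OF m] uv(2) using key[of "g u" "g v"] hg V by auto
    qed
    moreover have "{..<n} = g ` pverts G" using bij_g by (simp add: bij_betw_def)
    ultimately show ?thesis
      unfolding app_iso_def F_def with_proj_simps by (simp add: with_proj_def Cstar_verts)
  qed
  ultimately show ?thesis unfolding digraph_iso_def by blast
qed

lemma least_Q_eigenvalue_iso_le:
  assumes G: "pair_graph G" and H: "pair_graph H" and ne: "pverts G \<noteq> {}"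
    and iso: "digraph_iso (with_proj G) (with_proj H)"
  shows "least_Q_eigenvalue G \<le> least_Q_eigenvalue H"
proof -
  obtain F where F: "pre_digraph.digraph_isomorphism (with_proj G) F" "with_proj H = app_iso F (with_proj G)"
    using iso unfolding digraph_iso_def by blast
  define g where "g = iso_verts F"
  have inj: "inj_on g (pverts G)" "inj_on (iso_arcs F) (parcs G)"
    and ends: "\<And>e. e \<in> parcs G \<Longrightarrow> g (fst e) = iso_tail F (iso_arcs F e) \<and> g (snd e) = iso_head F (iso_arcs F e)"
    using F(1) unfolding pre_digraph.digraph_isomorphism_def g_def by auto
  have H_eq: "pverts H = g ` pverts G" "parcs H = iso_arcs F ` parcs G" "iso_tail F = fst" "iso_head F = snd"
    using arg_cong[OF F(2), of verts] arg_cong[OF F(2), of pre_digraph.arcs]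
      arg_cong[OF F(2), of tail] arg_cong[OF F(2), of head] by (simp_all add: g_def)
  have "pverts H \<noteq> {}" using ne H_eq by simp
  then obtain y where y: "\<exists>v\<in>pverts H. y v \<noteq> 0"
      "energy (parcs H) y / 2 = least_Q_eigenvalue H * (\<Sum>v\<in>pverts H. (y v)\<^sup>2)"
    using least_Q_eigenvalue_rayleigh(2)[OF H] by blast
  have sums: "(\<Sum>v\<in>pverts H. (y v)\<^sup>2) = (\<Sum>v\<in>pverts G. ((y \<circ> g) v)\<^sup>2)"
    unfolding H_eq by (simp add: sum.reindex[OF inj(1)])
  have "energy (parcs H) y = (\<Sum>e\<in>parcs G. (y (fst (iso_arcs F e)) + y (snd (iso_arcs F e)))\<^sup>2)"
    unfolding H_eq energy_def case_prod_unfold by (simp add: sum.reindex[OF inj(2)])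
  also have "\<dots> = energy (parcs G) (y \<circ> g)"
    unfolding energy_def case_prod_unfold by (intro sum.cong) (use ends H_eq in auto)
  finally have "least_Q_eigenvalue G * (\<Sum>v\<in>pverts H. (y v)\<^sup>2) \<le> least_Q_eigenvalue H * (\<Sum>v\<in>pverts H. (y v)\<^sup>2)"
    using least_Q_eigenvalue_rayleigh(1)[OF G ne, of "y \<circ> g"] y(2) unfolding sums by simp
  moreover have "0 < (\<Sum>v\<in>pverts H. (y v)\<^sup>2)"
  proof -
    obtain v where "v \<in> pverts H" "y v \<noteq> 0" using y(1) by blast
    then show ?thesis using pair_graph_arcs(1)[OF H] by (intro sum_pos2[of _ v]) auto
  qed
  ultimately show ?thesis by simp
qed

lemma least_Q_eigenvalue_iso:
  assumes G: "pair_graph G" and H: "pair_graph H" and ne: "pverts G \<noteq> {}"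
    and iso: "digraph_iso (with_proj G) (with_proj H)"
  shows "least_Q_eigenvalue G = least_Q_eigenvalue H"
proof (rule antisym)
  interpret G: pair_graph G by (rule G)
  show "least_Q_eigenvalue G \<le> least_Q_eigenvalue H" by (rule least_Q_eigenvalue_iso_le[OF G H ne iso])
  have iso': "digraph_iso (with_proj H) (with_proj G)"
    by (rule digraph_iso_swap[OF _ iso]) (rule G.wf_digraph_axioms)
  have "pverts H \<noteq> {}"
  proof -
    obtain F where "with_proj H = app_iso F (with_proj G)" using iso unfolding digraph_iso_def by blast
    then have "verts (with_proj H) = iso_verts F ` verts (with_proj G)" by simp
    then show ?thesis using ne by simp
  qed
  then show "least_Q_eigenvalue H \<le> least_Q_eigenvalue G" using iso' by (rule least_Q_eigenvalue_iso_le[OF H G])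
qed

text \<open>
  The comparison described at the beginning, for a minimiser \<open>x\<close> of the quotient of \<open>G\<close>. For \<open>n = 3\<close> the
  least eigenvalue of the triangle is \<open>1\<close>, so that the strictness argument is not available; there the
  labelling alone forces a triangle.
\<close>

theorem least_Q_eigenvalue_ge_Cstar:
  fixes G :: "'a pair_pre_digraph"
  assumes G: "pair_graph G" and S: "S \<subseteq> pverts G" and conn: "cut_connected (parcs G) S"
    and unc: "\<not> colourable (parcs G) S" and leaves: "\<And>v. v \<in> pverts G - S \<Longrightarrow> \<exists>u\<in>S. (u, v) \<in> parcs G"
    and n: "card (pverts G) = n" and m: "card S = m"
  shows "least_Q_eigenvalue (Cstar n 3 (m - 3)) \<le> least_Q_eigenvalue G \<and>
    (least_Q_eigenvalue G = least_Q_eigenvalue (Cstar n 3 (m - 3)) \<longleftrightarrow>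
      digraph_iso (with_proj G) (with_proj (Cstar n 3 (m - 3))))"
proof -
  note arcs = pair_graph_arcs[OF G]
  let ?C = "Cstar n 3 (m - 3)"
  have ne: "pverts G \<noteq> {}" using unc S unfolding colourable_def by auto
  obtain x where x: "\<exists>v\<in>pverts G. x v \<noteq> 0"
      "energy (parcs G) x / 2 = least_Q_eigenvalue G * (\<Sum>v\<in>pverts G. (x v)\<^sup>2)"
    using least_Q_eigenvalue_rayleigh(2)[OF G ne] by blast
  obtain h p q e0 f where bij: "bij_betw h {..<n} (pverts G)"
      and lab: "sorted_labelling n m (labelled_edges (parcs G) h n) (x \<circ> h) p q e0 f"
    using sorted_labelling_exists[OF arcs(1,3,4) S conn unc leaves, of x] unfolding n m by blast
  define E where "E = labelled_edges (parcs G) h n"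
  interpret sorted_labelling n m E "x \<circ> h" p q e0 f using lab by (simp add: E_def)
  have C: "pair_graph ?C" by (rule pair_graph_Cstar[OF m3 mn])
  have iso_eq: "least_Q_eigenvalue G = least_Q_eigenvalue ?C" if "digraph_iso (with_proj G) (with_proj ?C)"
    by (rule least_Q_eigenvalue_iso[OF G C ne that])
  have isoI: "digraph_iso (with_proj G) (with_proj ?C)" if "E = kite_edges n m"
    using that unfolding E_def by (rule digraph_iso_CstarI[OF G m3 mn bij])
  show ?thesis
  proof (cases "n = 3")
    case True
    then have "m = 3" "p = 2" "q = 2" using m3 mn e0p e1q by auto
    then have "(0, 2) \<in> E" "(1, 2) \<in> E" using e0p(1) e1q(1) by simp_all
    then have "kite_edges n m \<subseteq> E" using e01 \<open>m = 3\<close> True by (auto simp: kite_edges_iff)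
    moreover have "E \<subseteq> kite_edges n m"
    proof (rule subrelI)
      fix u v assume "(u, v) \<in> E"
      then have "u < v" "v < 3" using E_sub True by auto
      then show "(u, v) \<in> kite_edges n m" unfolding kite_edges_iff by presburger
    qed
    ultimately show ?thesis using isoI iso_eq by auto
  next
    case False
    then have n4: "4 \<le> n" using m3 mn by simp
    interpret kite_comparison n m E "x \<circ> h" p q e0 f "least_Q_eigenvalue ?C"
      by unfold_locales
        (use least_Q_eigenvalue_Cstar_pos[OF m3 mn] least_Q_eigenvalue_Cstar_less_1[OF m3 mn n4]
          kite_form_ge[OF m3 mn] in auto)
    have energy_eq: "energy E (x \<circ> h) = least_Q_eigenvalue G * (\<Sum>v\<in>pverts G. (x v)\<^sup>2)"
      using energy_labelled_edges[OF arcs(2,3,4) bij, of x] x(2) by (simp add: E_def)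
    have norm_eq: "(\<Sum>i<n. ((x \<circ> h) i)\<^sup>2) = (\<Sum>v\<in>pverts G. (x v)\<^sup>2)"
      using sum.reindex_bij_betw[OF bij, of "\<lambda>v. (x v)\<^sup>2"] by simp
    have pos: "0 < (\<Sum>v\<in>pverts G. (x v)\<^sup>2)"
    proof -
      obtain v where "v \<in> pverts G" "x v \<noteq> 0" using x(1) by blast
      then show ?thesis using arcs(1) by (intro sum_pos2[of _ v]) auto
    qed
    have "least_Q_eigenvalue ?C * (\<Sum>v\<in>pverts G. (x v)\<^sup>2) \<le> least_Q_eigenvalue G * (\<Sum>v\<in>pverts G. (x v)\<^sup>2)"
      using energy_ge unfolding energy_eq norm_eq .
    then have ge: "least_Q_eigenvalue ?C \<le> least_Q_eigenvalue G" using pos by simp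
    moreover have "digraph_iso (with_proj G) (with_proj ?C)" if eq: "least_Q_eigenvalue G = least_Q_eigenvalue ?C"
    proof (rule isoI)
      interpret extremal_labelling n m E "x \<circ> h" p q e0 f "least_Q_eigenvalue ?C"
      proof
        show "energy E (x \<circ> h) = least_Q_eigenvalue ?C * (\<Sum>i<n. ((x \<circ> h) i)\<^sup>2)"
          unfolding energy_eq norm_eq eq ..
        obtain v where v: "v \<in> pverts G" "x v \<noteq> 0" using x(1) by blast
        moreover have "v \<in> h ` {..<n}" using v(1) bij by (simp add: bij_betw_def)
        ultimately show "\<exists>i<n. (x \<circ> h) i \<noteq> 0" by auto
      qed
      show "E = kite_edges n m" by (rule edges_eq)
    qed
    ultimately show ?thesis using iso_eq by blast
  qed
qed

lemma Cstar_in_nonbipartite_graphs: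
  assumes "3 \<le> m" "m \<le> n" "1 \<le> g" "3 * g - 1 \<le> m" "m \<le> 3 * g + 1" "m = n \<or> m = 3 * g"
  shows "Cstar n 3 (m - 3) \<in> nonbipartite_graphs n g"
  unfolding nonbipartite_graphs_def
  using pair_graph_Cstar[OF assms(1,2)] connected_Cstar[OF assms(1,2)] not_bipartite_Cstar[OF assms(1,2)]
    domination_number_Cstar[OF assms] by (simp add: Cstar_verts)

lemma minimum_dominating_set:
  assumes "finite (pverts G)"
  obtains D where "dominating_set G D" "card D = domination_number G"
proof -
  have "finite {D. dominating_set G D}"
    by (rule finite_subset[of _ "Pow (pverts G)"]) (use assms in \<open>auto simp: dominating_set_def\<close>)
  moreover have "dominating_set G (pverts G)" by (simp add: dominating_set_def)
  ultimately have "domination_number G \<in> card ` {D. dominating_set G D}"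
    unfolding domination_number_def by (intro Min_in) auto
  then show thesis using that by auto
qed

theorem theorem4p2:
  fixes n \<gamma> :: nat
  assumes "n \<ge> 3" and "\<gamma> \<ge> 1"
  shows
    "(n = 3 * \<gamma> - 1 \<or> n = 3 * \<gamma> \<or> n = 3 * \<gamma> + 1 \<longrightarrow>
       Cstar n 3 (n - 4) \<in> nonbipartite_graphs n \<gamma> \<and>
       (\<forall>G \<in> (nonbipartite_graphs n \<gamma> :: 'a pair_pre_digraph set).
          least_Q_eigenvalue (Cstar n 3 (n - 4)) \<le> least_Q_eigenvalue G \<and>
          (least_Q_eigenvalue G = least_Q_eigenvalue (Cstar n 3 (n - 4)) \<longleftrightarrow>
             digraph_iso (with_proj G) (with_proj (Cstar n 3 (n - 4)))))) \<and>
     (n \<ge> 3 * \<gamma> + 2 \<longrightarrow>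
       Cstar n 3 (3 * \<gamma> - 3) \<in> nonbipartite_graphs n \<gamma> \<and>
       (\<forall>G \<in> (nonbipartite_graphs n \<gamma> :: 'a pair_pre_digraph set).
          least_Q_eigenvalue (Cstar n 3 (3 * \<gamma> - 3)) \<le> least_Q_eigenvalue G \<and>
          (least_Q_eigenvalue G = least_Q_eigenvalue (Cstar n 3 (3 * \<gamma> - 3)) \<longleftrightarrow>
             digraph_iso (with_proj G) (with_proj (Cstar n 3 (3 * \<gamma> - 3))))))"
proof (intro conjI impI ballI)
  assume n: "n = 3 * \<gamma> - 1 \<or> n = 3 * \<gamma> \<or> n = 3 * \<gamma> + 1"
  show "Cstar n 3 (n - 4) \<in> nonbipartite_graphs n \<gamma>"
    unfolding Cstar_last[OF assms(1)] by (rule Cstar_in_nonbipartite_graphs) (use assms n in auto)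
next
  assume "3 * \<gamma> + 2 \<le> n"
  then show "Cstar n 3 (3 * \<gamma> - 3) \<in> nonbipartite_graphs n \<gamma>"
    by (intro Cstar_in_nonbipartite_graphs) (use assms in auto)
next
  fix G :: "'a pair_pre_digraph" assume G: "G \<in> nonbipartite_graphs n \<gamma>"
  then have pg: "pair_graph G" and nG: "card (pverts G) = n" by (auto simp: nonbipartite_graphs_def)
  note arcs = pair_graph_arcs[OF pg]
  have conn: "cut_connected (parcs G) (pverts G)" and unc: "\<not> colourable (parcs G) (pverts G)"
    and dn: "domination_number G = \<gamma>"
    using G connected_iff_cut_connected[OF arcs(2,3)] bipartite_iff_colourable[OF arcs(2)]
    by (auto simp: nonbipartite_graphs_def)
  have "least_Q_eigenvalue (Cstar n 3 (n - 3)) \<le> least_Q_eigenvalue G \<and>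
    (least_Q_eigenvalue G = least_Q_eigenvalue (Cstar n 3 (n - 3)) \<longleftrightarrow>
      digraph_iso (with_proj G) (with_proj (Cstar n 3 (n - 3))))"
    by (rule least_Q_eigenvalue_ge_Cstar[OF pg order_refl conn unc _ nG nG]) simp
  then show "least_Q_eigenvalue (Cstar n 3 (n - 4)) \<le> least_Q_eigenvalue G"
    "least_Q_eigenvalue G = least_Q_eigenvalue (Cstar n 3 (n - 4)) \<longleftrightarrow>
      digraph_iso (with_proj G) (with_proj (Cstar n 3 (n - 4)))"
    unfolding Cstar_last[OF assms(1)] by auto
  assume n: "3 * \<gamma> + 2 \<le> n"
  obtain D where D: "dominating_set G D" "card D = \<gamma>" using minimum_dominating_set[OF arcs(1)] dn by blast
  have DV: "D \<subseteq> pverts G" using D(1) by (simp add: dominating_set_def)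
  have dom: "\<exists>u\<in>D. (u, v) \<in> parcs G" if "v \<in> pverts G - D" for v
  proof -
    have "\<exists>u\<in>D. (v, u) \<in> parcs G" using D(1) that by (simp add: dominating_set_def)
    then show ?thesis using arcs(3) by (blast dest: symD)
  qed
  have ne: "pverts G \<noteq> {}" using nG assms(1) by auto
  have le: "3 * card D \<le> card (pverts G)" using n nG D(2) by simp
  obtain S where S: "D \<subseteq> S" "S \<subseteq> pverts G" "cut_connected (parcs G) S" "\<not> colourable (parcs G) S" "card S = 3 * card D"
    by (rule dominated_core_exists[OF arcs(1) ne arcs(2,3) conn unc DV dom le])
  have leaves: "\<exists>u\<in>S. (u, v) \<in> parcs G" if "v \<in> pverts G - S" for v using dom[of v] that S(1) by blast
  have cS: "card S = 3 * \<gamma>" using S(5) D(2) by simp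
  have "least_Q_eigenvalue (Cstar n 3 (3 * \<gamma> - 3)) \<le> least_Q_eigenvalue G \<and>
    (least_Q_eigenvalue G = least_Q_eigenvalue (Cstar n 3 (3 * \<gamma> - 3)) \<longleftrightarrow>
      digraph_iso (with_proj G) (with_proj (Cstar n 3 (3 * \<gamma> - 3))))"
    by (rule least_Q_eigenvalue_ge_Cstar[OF pg S(2-4) leaves nG cS])
  then show "least_Q_eigenvalue (Cstar n 3 (3 * \<gamma> - 3)) \<le> least_Q_eigenvalue G"
    "least_Q_eigenvalue G = least_Q_eigenvalue (Cstar n 3 (3 * \<gamma> - 3)) \<longleftrightarrow>
      digraph_iso (with_proj G) (with_proj (Cstar n 3 (3 * \<gamma> - 3)))"
    by auto
qed

end
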